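(* For each $n$, let $\sigma_{n+1}$ be a uniformly random permutation of $\mathfrak{S}_{n+1}$. Then the random continuous functions $t\mapsto \frac{1}{\sqrt n}f_{\sigma_{n+1}}(nt)$, $t\in[0,1]$, converge in distribution (in $\mathcal{C}([0,1],\mathbb{R})$ with the uniform norm) to $\frac{1}{\sqrt3}\mathcal{B}$, where $\mathcal{B}$ is a standard Brownian motion on $[0,1]$.
   Context: For $\sigma\in\mathfrak{S}_{n+1}$ (written as a word $\sigma(1)\cdots\sigma(n+1)$), $i\in\{1,\dots,n\}$ is a descent of $\sigma$ if $\sigma(i+1)<\sigma(i)$. $f_\sigma:[0,n]\to\mathbb{R}$ is the piecewise linear function with $f_\sigma(0)=0$, linear on each $[i-1,i]$, and $f_\sigma(i)-f_\sigma(i-1)=-1$ if $i$ is a descent of $\sigma$ and $+1$ otherwise. *)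

theory Defs
  imports "HOL-Probability.Probability" "HOL-Combinatorics.Permutations"
begin

definition is_descent :: "(nat \<Rightarrow> nat) \<Rightarrow> nat \<Rightarrow> bool" where
  "is_descent \<sigma> i \<longleftrightarrow> \<sigma> (Suc i) < \<sigma> i"

definition step :: "(nat \<Rightarrow> nat) \<Rightarrow> nat \<Rightarrow> real" where
  "step \<sigma> i = (if is_descent \<sigma> i then -1 else 1)"

text \<open>The piecewise linear function f_sigma on [0,n]: f(0)=0, linear on each [i-1,i],
  with increment step i on [i-1,i]. (Defined on all reals; only [0,n] is used.)\<close>
definition f_perm :: "nat \<Rightarrow> (nat \<Rightarrow> nat) \<Rightarrow> real \<Rightarrow> real" where
  "f_perm n \<sigma> x = (\<Sum>i=1..n. step \<sigma> i * max 0 (min 1 (x - real (i - 1))))"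

definition standard_BM_01 :: "'a measure \<Rightarrow> ('a \<Rightarrow> real \<Rightarrow> real) \<Rightarrow> bool" where
  "standard_BM_01 M B \<longleftrightarrow> prob_space M \<and>
     (\<forall>\<omega>\<in>space M. B \<omega> 0 = 0 \<and> continuous_on {0..1} (B \<omega>)) \<and>
     (\<forall>s t. 0 \<le> s \<and> s < t \<and> t \<le> 1 \<longrightarrow>
        distributed M lborel (\<lambda>\<omega>. B \<omega> t - B \<omega> s) (\<lambda>x. ennreal (normal_density 0 (sqrt (t - s)) x))) \<and>
     (\<forall>(k::nat) (ts::nat \<Rightarrow> real). ts 0 \<ge> 0 \<and> ts k \<le> 1 \<and> (\<forall>i<k. ts i < ts (Suc i)) \<longrightarrow>
        prob_space.indep_vars M (\<lambda>_. borel) (\<lambda>i \<omega>. B \<omega> (ts (Suc i)) - B \<omega> (ts i)) {..<k})"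

definition bounded_continuous_functional_C01 :: "((real \<Rightarrow> real) \<Rightarrow> real) \<Rightarrow> bool" where
  "bounded_continuous_functional_C01 F \<longleftrightarrow>
     (\<exists>K. \<forall>g. continuous_on {0..1} g \<longrightarrow> \<bar>F g\<bar> \<le> K) \<and>
     (\<forall>g. continuous_on {0..1} g \<longrightarrow> (\<forall>\<epsilon>>0. \<exists>\<delta>>0. \<forall>h. continuous_on {0..1} h \<and>
         (SUP t\<in>{0..1}. \<bar>h t - g t\<bar>) < \<delta> \<longrightarrow> \<bar>F h - F g\<bar> < \<epsilon>))"

end

theory Submission
  imports Defs
begin

text \<open>
  Let $U_0, U_1, \dots$ be independent and uniform on $[0,1)$. The fractional parts
  $V_i$ of $U_0 + \dots + U_i$ are again independent and uniform, so their relative order is a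
  uniform permutation, and $V$ has a descent exactly when the integer part of the partial sum jumps.
  Hence the number of descents among the first $k$ positions is distributed, jointly in $k$, as
  $\lfloor U_0 + \dots + U_k \rfloor$, and $f_\sigma(k)$ differs by at most 2 from
  $2 \sum_{i<k} (1/2 - U_i)$, a random walk with steps of variance $1/3$.

  It remains to prove Donsker's theorem for this walk. It suffices to treat Lipschitz functionals,
  since a bounded continuous functional is the pointwise limit of Lipschitz functionals from below
  and from above. The walk is compared with its linear interpolation over $m$ blocks: the error is
  controlled uniformly in $n$ by a fourth moment maximal inequality, while for fixed $m$ the
  independent block increments converge by the central limit theorem, which Skorohod's theorem turns
  into pointwise convergence on a product space. Letting $m \to \infty$, the interpolations of the
  Brownian path converge uniformly.
\<close>

section \<open>Polygonal paths and functionals\<close>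

text \<open>The steps of \<open>f_perm\<close> at neighbouring positions are dependent, so the
  central limit theorem for independent summands does not apply to them directly; the coupling
  replaces the path by a random walk at a cost of at most 2, which vanishes after division by
  \<open>sqrt n\<close>. The variance 1/3 is that of \<open>2 * (1/2 - U)\<close>, namely 4/12.
  Lipschitz functionals matter because closeness of paths with high probability must become
  closeness of expectations: the modulus of a merely continuous functional varies with the path, a
  Lipschitz constant does not. The comparison with \<open>m\<close> blocks costs \<open>K * (4 *
  \<eta> + (2 * m + 4) / sqrt n) + 6 * C / (m * \<eta> ^ 4)\<close>. The last term is free of
  \<open>n\<close>, the middle one grows with \<open>m\<close>, so \<open>n\<close> tends to
  infinity for fixed \<open>m\<close>, and \<open>m\<close> only afterwards. The maximal inequality
  thus does the work of tightness. Nothing is assumed about measurability of \<open>F\<close>. Every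
  use passes through polygonal paths, on which \<open>F\<close> is a continuous function of finitely
  many increments; \<open>F\<close> of the Brownian path is a pointwise limit of such
  functions.\<close>

definition poly_path :: "nat \<Rightarrow> (nat \<Rightarrow> real) \<Rightarrow> real \<Rightarrow> real" where
  "poly_path m x t = (\<Sum>j<m. x j * max 0 (min 1 (real m * t - real j)))"

text \<open>Clamped weights make the path visibly linear in \<open>x\<close> and match
  \<open>f_perm\<close>; this lemma recovers the geometric picture. On cell \<open>j\<close>,
  earlier increments have weight 1, later ones weight 0, and increment \<open>j\<close> has weight
  \<open>\<theta>\<close>.\<close>

lemma poly_path_convex_combination:
  assumes "m > 0" "t \<in> {0..1}"
  obtains j \<theta> where "j < m" "0 \<le> \<theta>" "\<theta> \<le> 1" "real m * t = real j + \<theta>"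
    "\<And>x. poly_path m x t = (1 - \<theta>) * (\<Sum>i<j. x i) + \<theta> * (\<Sum>i<Suc j. x i)"
proof -
  \<comment> \<open>At \<open>t = 1\<close> the floor would give \<open>j = m\<close>, so the last
    cell is taken, with \<open>\<theta> = 1\<close>.\<close>
  define j where "j = (if t = 1 then m - 1 else nat \<lfloor>real m * t\<rfloor>)"
  define \<theta> where "\<theta> = real m * t - real j"
  have j: "j < m \<and> 0 \<le> \<theta> \<and> \<theta> \<le> 1"
  proof (cases "t = 1")
    case True
    then show ?thesis using assms by (auto simp: j_def \<theta>_def)
  next
    case False
    then have "real m * t < real m * 1" "0 \<le> real m * t"
      using assms by (auto intro!: mult_strict_left_mono)
    then show ?thesis using False unfolding j_def \<theta>_def by auto linarith+
  qed
  have "poly_path m x t = (1 - \<theta>) * (\<Sum>i<j. x i) + \<theta> * (\<Sum>i<Suc j. x i)" for x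
  proof -
    have "poly_path m x t = (\<Sum>i<m. if i < Suc j then (if i < j then x i else \<theta> * x j) else 0)"
      unfolding poly_path_def
    proof (intro sum.cong refl)
      fix i
      consider "i < j" | "i = j" | "i > j" by linarith
      then show "x i * max 0 (min 1 (real m * t - real i)) =
        (if i < Suc j then (if i < j then x i else \<theta> * x j) else 0)"
      proof cases
        case 1
        then have "real i + 1 \<le> real j" by simp
        then show ?thesis using 1 j by (auto simp: \<theta>_def max_def min_def)
      next
        case 2
        then show ?thesis using j by (auto simp: \<theta>_def)
      next
        case 3
        then have "real j + 1 \<le> real i" by simp
        then show ?thesis using 3 j by (auto simp: \<theta>_def max_def min_def)
      qed
    qed
    also have "\<dots> = (\<Sum>i<Suc j. if i < j then x i else \<theta> * x j)"
      using j by (intro sum.mono_neutral_cong_right) auto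
    also have "\<dots> = (\<Sum>i<j. x i) + \<theta> * x j"
      by simp
    finally show ?thesis by (simp add: algebra_simps)
  qed
  with j show thesis by (intro that[of j \<theta>]) (auto simp: \<theta>_def)
qed

lemma poly_path_cong: "(\<And>j. j < m \<Longrightarrow> x j = y j) \<Longrightarrow> poly_path m x = poly_path m y"
  by (auto simp: poly_path_def fun_eq_iff intro!: sum.cong)

lemma continuous_on_poly_path: "continuous_on A (poly_path m x)"
  unfolding poly_path_def[abs_def] by (intro continuous_on_sum continuous_on_mult continuous_on_max continuous_on_min
      continuous_on_diff continuous_on_const continuous_on_id)

lemma abs_poly_path_diff_le:
  "\<bar>poly_path m x t - poly_path m y t\<bar> \<le> (\<Sum>j<m. \<bar>x j - y j\<bar>)"
proof -
  have "poly_path m x t - poly_path m y t = (\<Sum>j<m. (x j - y j) * max 0 (min 1 (real m * t - real j)))"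
    by (simp add: poly_path_def sum_subtractf algebra_simps)
  also have "\<bar>\<dots>\<bar> \<le> (\<Sum>j<m. \<bar>(x j - y j) * max 0 (min 1 (real m * t - real j))\<bar>)"
    by (rule sum_abs)
  also have "\<dots> \<le> (\<Sum>j<m. \<bar>x j - y j\<bar>)"
    by (intro sum_mono) (auto simp: abs_mult intro!: mult_left_le)
  finally show ?thesis .
qed

text \<open>Any pointwise majorant \<open>d\<close> replaces the \<open>SUP\<close> of the
  definition. The filter is arbitrary because the lemma serves both sequences of paths and limits at
  a point of the space of increments.\<close>

lemma bcf_tendsto:
  assumes F: "bounded_continuous_functional_C01 F"
    and g: "continuous_on {0..1} g" and h: "\<And>x. continuous_on {0..1} (h x)"
    and le: "\<And>x t. t \<in> {0..1} \<Longrightarrow> \<bar>h x t - g t\<bar> \<le> d x" and d: "(d \<longlongrightarrow> 0) A"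
  shows "((\<lambda>x. F (h x)) \<longlongrightarrow> F g) A"
proof (rule tendstoI)
  fix e :: real assume "e > 0"
  then obtain \<delta> where \<delta>: "\<delta> > 0" "\<And>h. continuous_on {0..1} h \<Longrightarrow>
      (SUP t\<in>{0..1}. \<bar>h t - g t\<bar>) < \<delta> \<Longrightarrow> \<bar>F h - F g\<bar> < e"
    using F g unfolding bounded_continuous_functional_C01_def by meson
  have "eventually (\<lambda>x. d x < \<delta>) A"
    using d \<delta>(1) by (rule order_tendstoD)
  then show "eventually (\<lambda>x. dist (F (h x)) (F g) < e) A"
  proof eventually_elim
    case (elim x)
    have "(SUP t\<in>{0..1}. \<bar>h x t - g t\<bar>) \<le> d x"
      by (rule cSUP_least) (auto intro: le)
    with elim h \<delta>(2)[of "h x"] show ?case by (auto simp: dist_real_def)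
  qed
qed

lemma continuous_bcf_poly_path:
  assumes "bounded_continuous_functional_C01 F"
  shows "continuous_on UNIV (\<lambda>x. F (poly_path m x))"
proof (clarsimp simp: continuous_on_def)
  fix x :: "nat \<Rightarrow> real"
  have "((\<lambda>y. y j) \<longlongrightarrow> x j) (at x)" for j
    using continuous_on_product_coordinates[of j] by (auto simp: continuous_on_def)
  then have "((\<lambda>y. \<Sum>j<m. \<bar>y j - x j\<bar>) \<longlongrightarrow> (\<Sum>j<m. \<bar>x j - x j\<bar>)) (at x)"
    by (intro tendsto_intros)
  then show "((\<lambda>x. F (poly_path m x)) \<longlongrightarrow> F (poly_path m x)) (at x)"
    by (intro bcf_tendsto[OF assms, where d = "\<lambda>y. \<Sum>j<m. \<bar>y j - x j\<bar>"] continuous_on_poly_path abs_poly_path_diff_le) auto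
qed

text \<open>The map from increments to \<open>F (poly_path m x)\<close> is continuous for the
  product topology, whose Borel sets are the product sigma-algebra since the index set is countable.
  Coordinates from \<open>m\<close> on do not enter the path and are set to 0.\<close>

lemma measurable_bcf_poly_path:
  assumes F: "bounded_continuous_functional_C01 F"
    and X: "\<And>j. j < m \<Longrightarrow> X j \<in> borel_measurable M"
  shows "(\<lambda>\<omega>. F (poly_path m (\<lambda>j. X j \<omega>))) \<in> borel_measurable M"
proof -
  have "(\<lambda>\<omega> j. if j < m then X j \<omega> else 0) \<in> measurable M (Pi\<^sub>M UNIV (\<lambda>_. borel))"
    by (rule measurable_PiM_single', rename_tac j, case_tac "j < m") (auto simp: X split: if_split)
  moreover have "(\<lambda>x. F (poly_path m x)) \<in> borel_measurable (Pi\<^sub>M UNIV (\<lambda>_::nat. borel))"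
    using borel_measurable_continuous_onI[OF continuous_bcf_poly_path[OF F]]
    by (simp add: measurable_cong_sets[OF sets_PiM_equal_borel refl])
  ultimately have "(\<lambda>\<omega>. F (poly_path m (\<lambda>j. if j < m then X j \<omega> else 0))) \<in> borel_measurable M"
    by (rule measurable_compose)
  then show ?thesis by (simp cong: poly_path_cong)
qed

text \<open>The increments telescope because \<open>g 0 = 0\<close>, so the polygon at
  \<open>t\<close> is a convex combination of the values of \<open>g\<close> at the two ends of the
  cell of \<open>t\<close>. Both ends are within \<open>1 / m\<close> of \<open>t\<close>, and
  \<open>g\<close> is uniformly continuous.\<close>

lemma poly_path_increments_uniform_limit:
  fixes g :: "real \<Rightarrow> real"
  assumes g: "continuous_on {0..1} g" "g 0 = 0" and "e > 0"
  shows "eventually (\<lambda>m. \<forall>t\<in>{0..1}.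
    \<bar>poly_path m (\<lambda>j. g (real (Suc j) / real m) - g (real j / real m)) t - g t\<bar> \<le> e) sequentially"
proof -
  have "uniformly_continuous_on {0..1} g"
    using g by (intro compact_uniformly_continuous) auto
  then obtain \<delta> where \<delta>: "\<delta> > 0" "\<And>s t. s \<in> {0..1} \<Longrightarrow> t \<in> {0..1} \<Longrightarrow> \<bar>s - t\<bar> < \<delta> \<Longrightarrow> \<bar>g s - g t\<bar> < e"
    using \<open>e > 0\<close> unfolding uniformly_continuous_on_def dist_real_def by (metis abs_minus_commute)
  have "eventually (\<lambda>m. 1 / real m < \<delta>) sequentially"
    by (rule order_tendstoD(2)[OF lim_1_over_n \<delta>(1)])
  then show ?thesis
    using eventually_gt_at_top[of 0]
  proof eventually_elim
    case (elim m)
    show ?case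
    proof
      fix t :: real assume t: "t \<in> {0..1}"
      let ?x = "\<lambda>j. g (real (Suc j) / real m) - g (real j / real m)"
      obtain j \<theta> where j: "j < m" "0 \<le> \<theta>" "\<theta> \<le> 1" "real m * t = real j + \<theta>"
        and eq: "\<And>x. poly_path m x t = (1 - \<theta>) * (\<Sum>i<j. x i) + \<theta> * (\<Sum>i<Suc j. x i)"
        by (rule poly_path_convex_combination[OF elim(2) t]) blast
      have tel: "(\<Sum>i<k. ?x i) = g (real k / real m)" for k
        using sum_lessThan_telescope[of "\<lambda>i. g (real i / real m)" k] g by simp
      have t_eq: "t = (real j + \<theta>) / real m"
        using j elim(2) by (simp add: field_simps)
      have "\<bar>real j / real m - t\<bar> = \<theta> / real m" "\<bar>real (Suc j) / real m - t\<bar> = (1 - \<theta>) / real m"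
        using j elim(2) unfolding t_eq by (simp_all flip: diff_divide_distrib)
      moreover have "\<theta> / real m \<le> 1 / real m" "(1 - \<theta>) / real m \<le> 1 / real m"
        using j by (simp_all add: divide_right_mono)
      ultimately have "\<bar>real j / real m - t\<bar> < \<delta>" "\<bar>real (Suc j) / real m - t\<bar> < \<delta>"
        using elim(1) by (metis order_le_less_trans)+
      then have b: "\<bar>g (real j / real m) - g t\<bar> < e" "\<bar>g (real (Suc j) / real m) - g t\<bar> < e"
        using j t by (auto intro!: \<delta>(2))
      have "poly_path m ?x t - g t
          = (1 - \<theta>) * (g (real j / real m) - g t) + \<theta> * (g (real (Suc j) / real m) - g t)"
        unfolding eq tel by (simp add: algebra_simps)
      also have "\<bar>\<dots>\<bar> \<le> (1 - \<theta>) * e + \<theta> * e"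
        using j b by (intro order_trans[OF abs_triangle_ineq] add_mono)
          (auto simp: abs_mult intro!: mult_left_mono)
      finally show "\<bar>poly_path m ?x t - g t\<bar> \<le> e" by (simp add: algebra_simps)
    qed
  qed
qed

lemma bdd_above_abs_diff_C01:
  fixes g h :: "real \<Rightarrow> real"
  assumes "continuous_on {0..1} g" "continuous_on {0..1} h"
  shows "bdd_above ((\<lambda>t. \<bar>g t - h t\<bar>) ` {0..1})"
  by (intro bounded_imp_bdd_above compact_imp_bounded compact_continuous_image
      continuous_on_rabs continuous_on_diff assms) auto

lemma bcf_poly_path_increments_tendsto:
  assumes F: "bounded_continuous_functional_C01 F"
    and g: "continuous_on {0..1} g" "g 0 = 0"
  shows "(\<lambda>m. F (poly_path m (\<lambda>j. g (real (Suc j) / real m) - g (real j / real m)))) \<longlonglongrightarrow> F g"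
proof (rule bcf_tendsto[OF F g(1) continuous_on_poly_path])
  let ?h = "\<lambda>m. poly_path m (\<lambda>j. g (real (Suc j) / real m) - g (real j / real m))"
  let ?d = "\<lambda>m. SUP t\<in>{0..1}. \<bar>?h m t - g t\<bar>"
  have bdd: "bdd_above ((\<lambda>t. \<bar>?h m t - g t\<bar>) ` {0..1})" for m
    by (intro bdd_above_abs_diff_C01 continuous_on_poly_path g)
  show "\<bar>?h m t - g t\<bar> \<le> ?d m" if "t \<in> {0..1}" for m t
    by (rule cSUP_upper[OF that bdd])
  show "?d \<longlonglongrightarrow> 0"
  proof (rule LIMSEQ_I)
    fix r :: real assume r: "r > 0"
    have "eventually (\<lambda>m. \<forall>t\<in>{0..1}. \<bar>?h m t - g t\<bar> \<le> r / 2) sequentially"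
      using r by (intro poly_path_increments_uniform_limit g) auto
    then obtain N where N: "\<And>m. m \<ge> N \<Longrightarrow> \<forall>t\<in>{0..1}. \<bar>?h m t - g t\<bar> \<le> r / 2"
      by (auto simp: eventually_sequentially)
    have "norm (?d m - 0) < r" if "m \<ge> N" for m
    proof -
      have "?d m \<le> r / 2" by (rule cSUP_least) (use N[OF that] in auto)
      moreover have "0 \<le> ?d m"
        using cSUP_upper[OF _ bdd, of 0 m] by (meson abs_ge_zero atLeastAtMost_iff order_refl order_trans zero_le_one)
      ultimately show ?thesis using r by simp
    qed
    then show "\<exists>no. \<forall>n\<ge>no. norm (?d n - 0) < r" by blast
  qed
qed

section \<open>Reduction to bounded Lipschitz functionals\<close>

definition bounded_lipschitz_functional_C01 :: "real \<Rightarrow> real \<Rightarrow> ((real \<Rightarrow> real) \<Rightarrow> real) \<Rightarrow> bool" where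
  "bounded_lipschitz_functional_C01 C K F \<longleftrightarrow> K \<ge> 0 \<and>
     (\<forall>g. continuous_on {0..1} g \<longrightarrow> \<bar>F g\<bar> \<le> C) \<and>
     (\<forall>g h d. continuous_on {0..1} g \<longrightarrow> continuous_on {0..1} h \<longrightarrow>
        (\<forall>t\<in>{0..1}. \<bar>g t - h t\<bar> \<le> d) \<longrightarrow> \<bar>F g - F h\<bar> \<le> K * d)"

lemma bounded_lipschitz_imp_continuous:
  assumes "bounded_lipschitz_functional_C01 C K F"
  shows "bounded_continuous_functional_C01 F"
  unfolding bounded_continuous_functional_C01_def
proof (intro conjI allI impI)
  show "\<exists>K. \<forall>g. continuous_on {0..1} g \<longrightarrow> \<bar>F g\<bar> \<le> K"
    using assms by (auto simp: bounded_lipschitz_functional_C01_def)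
  fix g :: "real \<Rightarrow> real" and e :: real
  assume g: "continuous_on {0..1} g" and e: "e > 0"
  have K: "K \<ge> 0" using assms by (auto simp: bounded_lipschitz_functional_C01_def)
  \<comment> \<open>\<open>K + 1\<close> instead of \<open>K\<close> guards against
    \<open>K = 0\<close>.\<close>
  have "\<bar>F h - F g\<bar> < e" if h: "continuous_on {0..1} h" and lt: "(SUP t\<in>{0..1}. \<bar>h t - g t\<bar>) < e / (K + 1)" for h
  proof -
    have "\<bar>F h - F g\<bar> \<le> K * (SUP t\<in>{0..1}. \<bar>h t - g t\<bar>)"
      using assms g h cSUP_upper[OF _ bdd_above_abs_diff_C01[OF h g]]
      by (auto simp: bounded_lipschitz_functional_C01_def)
    also have "\<dots> \<le> K * (e / (K + 1))"
      using lt K by (intro mult_left_mono) auto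
    also have "\<dots> < e" using K e by (simp add: field_simps)
    finally show ?thesis .
  qed
  moreover have "e / (K + 1) > 0" using K e by simp
  ultimately show "\<exists>\<delta>>0. \<forall>h. continuous_on {0..1} h \<and> (SUP t\<in>{0..1}. \<bar>h t - g t\<bar>) < \<delta> \<longrightarrow> \<bar>F h - F g\<bar> < e"
    by blast
qed

text \<open>\<open>E k\<close> is the Lipschitz regularization of \<open>F\<close>, the infimal
  convolution with \<open>k\<close> times the sup distance. As an infimum of
  \<open>k\<close>-Lipschitz functions it is \<open>k\<close>-Lipschitz, taking \<open>h = g\<close>
  shows \<open>E k g \<le> F g\<close>, and boundedness of \<open>F\<close> keeps the infimum
  finite.\<close>

lemma lipschitz_lower_envelopes:
  assumes F: "bounded_continuous_functional_C01 F"
  obtains C E where "\<And>k::nat. bounded_lipschitz_functional_C01 C (real k) (E k)"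
    "\<And>k g. continuous_on {0..1} g \<Longrightarrow> E k g \<le> F g"
    "\<And>g. continuous_on {0..1} g \<Longrightarrow> (\<lambda>k. E k g) \<longlonglongrightarrow> F g"
proof -
  obtain C where C: "\<And>g. continuous_on {0..1} g \<Longrightarrow> \<bar>F g\<bar> \<le> C"
    using F unfolding bounded_continuous_functional_C01_def by blast
  define N where "N g h = (SUP t\<in>{0..1}. \<bar>h t - g t\<bar>)" for g h :: "real \<Rightarrow> real"
  define A where "A = {h :: real \<Rightarrow> real. continuous_on {0..1} h}"
  define E where "E k g = (INF h\<in>A. F h + real k * N g h)" for k :: nat and g
  have N_upper: "\<bar>h t - g t\<bar> \<le> N g h" if "g \<in> A" "h \<in> A" "t \<in> {0..1}" for g h t
    unfolding N_def using that by (intro cSUP_upper bdd_above_abs_diff_C01) (auto simp: A_def)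
  have N_nonneg: "N g h \<ge> 0" if "g \<in> A" "h \<in> A" for g h
    using N_upper[OF that, of 0] by auto
  have N_least: "N g h \<le> d" if "\<And>t. t \<in> {0..1} \<Longrightarrow> \<bar>h t - g t\<bar> \<le> d" for g h d
    unfolding N_def by (rule cSUP_least) (use that in auto)
  have A0: "A \<noteq> {}" using continuous_on_const[of "{0..1}" "0::real"] unfolding A_def by blast
  have lower: "- C \<le> F h + real k * N g h" if "g \<in> A" "h \<in> A" for g h k
  proof -
    have "0 \<le> real k * N g h" using N_nonneg[OF that] by simp
    moreover have "\<bar>F h\<bar> \<le> C" using C that by (simp add: A_def)
    ultimately show ?thesis by linarith
  qed
  have bdd: "bdd_below ((\<lambda>h. F h + real k * N g h) ` A)" if "g \<in> A" for g k
    using lower[OF that] by (rule bdd_belowI2)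
  have E_lower: "E k g \<le> F h + real k * N g h" if "g \<in> A" "h \<in> A" for k g h
    unfolding E_def by (rule cINF_lower[OF bdd[OF that(1)] that(2)])
  have E_greatest: "x \<le> E k g" if "\<And>h. h \<in> A \<Longrightarrow> x \<le> F h + real k * N g h" for x k g
    unfolding E_def by (rule cINF_greatest[OF A0 that])
  have Ngg: "N g g = 0" for g by (simp add: N_def)
  have E_le: "E k g \<le> F g" if "g \<in> A" for k g
    using E_lower[OF that that] by (simp add: Ngg)
  have E_ge: "- C \<le> E k g" if "g \<in> A" for k g
    by (intro E_greatest lower that)
  have E_diff: "E k g \<le> E k h + real k * d"
    if g: "g \<in> A" and h: "h \<in> A" and d: "\<And>t. t \<in> {0..1} \<Longrightarrow> \<bar>g t - h t\<bar> \<le> d" for k g h d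
  proof -
    have "E k g - real k * d \<le> E k h"
    proof (rule E_greatest)
      fix f assume f: "f \<in> A"
      have "N g f \<le> N h f + d"
      proof (rule N_least)
        fix t :: real assume "t \<in> {0..1}"
        with N_upper[OF h f this] d[of t] show "\<bar>f t - g t\<bar> \<le> N h f + d" by linarith
      qed
      then have "real k * N g f \<le> real k * (N h f + d)" by (intro mult_left_mono) auto
      with E_lower[OF g f, of k] show "E k g - real k * d \<le> F f + real k * N h f"
        by (simp add: algebra_simps)
    qed
    then show ?thesis by simp
  qed
  have "bounded_lipschitz_functional_C01 C (real k) (E k)" for k
    unfolding bounded_lipschitz_functional_C01_def
  proof (intro conjI allI impI)
    fix g :: "real \<Rightarrow> real" assume g: "continuous_on {0..1} g"
    show "\<bar>E k g\<bar> \<le> C"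
      using g C[OF g] E_le[of g k] E_ge[of g k] by (auto simp: A_def)
    fix h d assume "continuous_on {0..1} h" "\<forall>t\<in>{0..1}. \<bar>g t - h t\<bar> \<le> d"
    with g E_diff[of g h d k] E_diff[of h g d k] show "\<bar>E k g - E k h\<bar> \<le> real k * d"
      by (auto simp: A_def abs_minus_commute abs_le_iff)
  qed simp
  moreover have "(\<lambda>k. E k g) \<longlonglongrightarrow> F g" if g: "continuous_on {0..1} g" for g
  proof (rule LIMSEQ_I)
    fix r :: real assume r: "r > 0"
    have gA: "g \<in> A" using g by (simp add: A_def)
    obtain \<delta> where \<delta>: "\<delta> > 0" "\<And>h. h \<in> A \<Longrightarrow> N g h < \<delta> \<Longrightarrow> \<bar>F h - F g\<bar> < r / 2"
      using F g half_gt_zero[OF r] unfolding bounded_continuous_functional_C01_def N_def A_def mem_Collect_eq by meson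
    obtain k0 :: nat where k0: "real k0 > 2 * C / \<delta>" using reals_Archimedean2 by blast
    \<comment> \<open>Competitors \<open>h\<close> within \<open>\<delta>\<close> of
      \<open>g\<close> have \<open>F h\<close> close to \<open>F g\<close> by continuity. For the
      others the penalty is at least \<open>k * \<delta> \<ge> 2 * C\<close>, which exceeds any
      possible gain since \<open>F\<close> varies by at most \<open>2 * C\<close>.\<close>
    have "norm (E k g - F g) < r" if k: "k \<ge> k0" for k
    proof -
      have "F g - r / 2 \<le> E k g"
      proof (rule E_greatest)
        fix h assume h: "h \<in> A"
        show "F g - r / 2 \<le> F h + real k * N g h"
        proof (cases "N g h < \<delta>")
          case True
          have "0 \<le> real k * N g h" using N_nonneg[OF gA h] by simp
          with \<delta>(2)[OF h True] show ?thesis by linarith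
        next
          case False
          have "2 * C / \<delta> \<le> real k" using k k0 by linarith
          then have "2 * C \<le> real k * \<delta>" using \<delta>(1) by (simp add: field_simps)
          also have "\<dots> \<le> real k * N g h" using False by (intro mult_left_mono) auto
          finally show ?thesis
            using C[OF g] C[of h] h r by (auto simp: A_def abs_le_iff)
        qed
      qed
      with E_le[OF gA, of k] r show ?thesis by (simp add: abs_if)
    qed
    then show "\<exists>no. \<forall>k\<ge>no. norm (E k g - F g) < r" by blast
  qed
  ultimately show thesis using E_le by (intro that[of C E]) (auto simp: A_def)
qed

text \<open>A lower envelope whose expectation under the limit is within \<open>e\<close> of that of
  \<open>F\<close> is fixed first, by dominated convergence. The Lipschitz case and
  \<open>E k \<le> F\<close> then bound the expectations of \<open>F\<close> from below for large
  \<open>n\<close>.\<close>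

lemma expectation_tendsto_of_lipschitz:
  fixes P :: "nat \<Rightarrow> 'b measure" and M :: "'a measure"
  assumes P: "\<And>n. prob_space (P n)" and M: "prob_space M"
    and contX: "\<And>n \<omega>. continuous_on {0..1} (X n \<omega>)"
    and contY: "\<And>\<omega>. \<omega> \<in> space M \<Longrightarrow> continuous_on {0..1} (Y \<omega>)"
    and measX: "\<And>F n. bounded_continuous_functional_C01 F \<Longrightarrow> (\<lambda>\<omega>. F (X n \<omega>)) \<in> borel_measurable (P n)"
    and measY: "\<And>F. bounded_continuous_functional_C01 F \<Longrightarrow> (\<lambda>\<omega>. F (Y \<omega>)) \<in> borel_measurable M"
    and lip: "\<And>C K F. bounded_lipschitz_functional_C01 C K F \<Longrightarrow>
      (\<lambda>n. \<integral>\<omega>. F (X n \<omega>) \<partial>P n) \<longlonglongrightarrow> (\<integral>\<omega>. F (Y \<omega>) \<partial>M)"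
    and F: "bounded_continuous_functional_C01 F"
  shows "(\<lambda>n. \<integral>\<omega>. F (X n \<omega>) \<partial>P n) \<longlonglongrightarrow> (\<integral>\<omega>. F (Y \<omega>) \<partial>M)"
proof -
  interpret M: prob_space M by fact
  have lower: "eventually (\<lambda>n. (\<integral>\<omega>. F (Y \<omega>) \<partial>M) - e < (\<integral>\<omega>. F (X n \<omega>) \<partial>P n)) sequentially"
    if F: "bounded_continuous_functional_C01 F" and e: "e > 0" for F e
  proof -
    obtain C E where E: "\<And>k::nat. bounded_lipschitz_functional_C01 C (real k) (E k)"
      "\<And>k g. continuous_on {0..1} g \<Longrightarrow> E k g \<le> F g"
      "\<And>g. continuous_on {0..1} g \<Longrightarrow> (\<lambda>k. E k g) \<longlonglongrightarrow> F g"
      using lipschitz_lower_envelopes[OF F] by metis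
    have Ec: "bounded_continuous_functional_C01 (E k)" for k
      using E(1) by (rule bounded_lipschitz_imp_continuous)
    have EC: "\<bar>E k g\<bar> \<le> C" if "continuous_on {0..1} g" for k g
      using E(1) that by (auto simp: bounded_lipschitz_functional_C01_def)
    have "(\<lambda>k. \<integral>\<omega>. E k (Y \<omega>) \<partial>M) \<longlonglongrightarrow> (\<integral>\<omega>. F (Y \<omega>) \<partial>M)"
      by (rule integral_dominated_convergence[where w = "\<lambda>_. C"])
         (auto simp: contY EC intro!: measY F Ec E(3))
    then have "eventually (\<lambda>k. (\<integral>\<omega>. F (Y \<omega>) \<partial>M) - e < (\<integral>\<omega>. E k (Y \<omega>) \<partial>M)) sequentially"
      using e by (intro order_tendstoD) auto
    then obtain k where k: "(\<integral>\<omega>. F (Y \<omega>) \<partial>M) - e < (\<integral>\<omega>. E k (Y \<omega>) \<partial>M)"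
      by (auto simp: eventually_sequentially)
    have "eventually (\<lambda>n. (\<integral>\<omega>. F (Y \<omega>) \<partial>M) - e < (\<integral>\<omega>. E k (X n \<omega>) \<partial>P n)) sequentially"
      using lip[OF E(1)] k by (rule order_tendstoD)
    then show ?thesis
    proof eventually_elim
      case (elim n)
      interpret P: prob_space "P n" by fact
      obtain C' where C': "\<And>g. continuous_on {0..1} g \<Longrightarrow> \<bar>F g\<bar> \<le> C'"
        using F unfolding bounded_continuous_functional_C01_def by blast
      have "(\<integral>\<omega>. E k (X n \<omega>) \<partial>P n) \<le> (\<integral>\<omega>. F (X n \<omega>) \<partial>P n)"
        by (intro integral_mono E(2) contX P.integrable_const_bound[where B = C] P.integrable_const_bound[where B = C'] measX F Ec)
           (auto simp: EC C' contX)
      with elim show ?case by simp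
    qed
  qed
  \<comment> \<open>The upper bound is the lower bound for \<open>- F\<close>.\<close>
  have nF: "bounded_continuous_functional_C01 (\<lambda>g. - F g)"
    using F by (auto simp: bounded_continuous_functional_C01_def abs_minus_commute)
  show ?thesis
  proof (rule tendstoI)
    fix e :: real assume "e > 0"
    show "eventually (\<lambda>n. dist (\<integral>\<omega>. F (X n \<omega>) \<partial>P n) (\<integral>\<omega>. F (Y \<omega>) \<partial>M) < e) sequentially"
      using lower[OF F \<open>e > 0\<close>] lower[OF nF \<open>e > 0\<close>]
      by eventually_elim (auto simp: dist_real_def)
  qed
qed

section \<open>A fourth moment maximal inequality\<close>

locale bounded_centered_sequence = prob_space +
  fixes X :: "nat \<Rightarrow> 'a \<Rightarrow> real"
  assumes indep: "indep_vars (\<lambda>_. borel) X UNIV"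
    and mean: "\<And>i. expectation (X i) = 0"
    and bounded: "\<And>i \<omega>. \<omega> \<in> space M \<Longrightarrow> \<bar>X i \<omega>\<bar> \<le> 1"
begin

definition S :: "nat \<Rightarrow> 'a \<Rightarrow> real" where
  "S k \<omega> = (\<Sum>i<k. X i \<omega>)"

lemma X_measurable [measurable]: "X i \<in> borel_measurable M"
  using indep by (auto simp: indep_vars_def)

lemma S_measurable [measurable]: "S k \<in> borel_measurable M"
  unfolding S_def[abs_def] by measurable

lemma abs_S_le: "\<omega> \<in> space M \<Longrightarrow> \<bar>S k \<omega>\<bar> \<le> real k"
  unfolding S_def using bounded by (intro order_trans[OF sum_abs] order_trans[OF sum_bounded_above[where K = 1]]) auto

lemma integrable_bounded:
  assumes "f \<in> borel_measurable M" "\<And>\<omega>. \<omega> \<in> space M \<Longrightarrow> \<bar>f \<omega>\<bar> \<le> (B::real)"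
  shows "integrable M f"
  using assms by (intro integrable_const_bound[where B = B]) auto

lemma integrable_S_X: "integrable M (\<lambda>\<omega>. S k \<omega> ^ a * X i \<omega> ^ b)"
proof (rule integrable_bounded)
  fix \<omega> assume "\<omega> \<in> space M"
  then have "\<bar>S k \<omega>\<bar> ^ a * \<bar>X i \<omega>\<bar> ^ b \<le> real k ^ a * 1 ^ b"
    by (intro mult_mono power_mono abs_S_le bounded) auto
  then show "\<bar>S k \<omega> ^ a * X i \<omega> ^ b\<bar> \<le> real k ^ a"
    by (simp add: abs_mult power_abs)
qed measurable

lemma integrable_S: "integrable M (\<lambda>\<omega>. S k \<omega> ^ a)"
  using integrable_S_X[of k a 0 0] by simp

lemma integrable_X: "integrable M (\<lambda>\<omega>. X i \<omega> ^ b)"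
  using integrable_S_X[of 0 0 i b] by simp

text \<open>\<open>S k\<close> involves only indices below \<open>k\<close>, hence is independent of
  \<open>X k\<close>. All mixed moments in the expansions of \<open>S (Suc k)\<close> factor through
  this.\<close>

lemma expectation_S_X:
  "expectation (\<lambda>\<omega>. S k \<omega> ^ a * X k \<omega> ^ b) = expectation (\<lambda>\<omega>. S k \<omega> ^ a) * expectation (\<lambda>\<omega>. X k \<omega> ^ b)"
proof -
  have "indep_var borel (X k) borel (\<lambda>\<omega>. \<Sum>i\<in>{..<k}. X i \<omega>)"
    by (rule indep_vars_sum) (auto intro: indep_vars_subset[OF indep])
  then have "indep_var borel ((\<lambda>x. x ^ b) \<circ> X k) borel ((\<lambda>x. x ^ a) \<circ> S k)"
    unfolding S_def[abs_def] by (rule indep_var_compose) auto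
  then have "indep_var borel (\<lambda>\<omega>. X k \<omega> ^ b) borel (\<lambda>\<omega>. S k \<omega> ^ a)"
    by (simp add: comp_def)
  from indep_var_lebesgue_integral[OF this integrable_X integrable_S]
  show ?thesis by (simp add: mult.commute)
qed

lemma expectation_X_power_le: "expectation (\<lambda>\<omega>. X i \<omega> ^ b) \<le> 1"
proof -
  have "expectation (\<lambda>\<omega>. X i \<omega> ^ b) \<le> expectation (\<lambda>_. 1)"
  proof (rule integral_mono[OF integrable_X])
    fix \<omega> assume "\<omega> \<in> space M"
    then have "\<bar>X i \<omega> ^ b\<bar> \<le> 1"
      using bounded by (simp add: power_abs power_le_one)
    then show "X i \<omega> ^ b \<le> 1" by simp
  qed auto
  then show ?thesis by (simp add: prob_space)
qed

lemma expectation_S: "expectation (S k) = 0"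
  unfolding S_def[abs_def] using integrable_X[of _ 1] by (subst Bochner_Integration.integral_sum) (auto simp: mean)

lemma second_moment_le: "expectation (\<lambda>\<omega>. S k \<omega> ^ 2) \<le> real k"
proof (induction k)
  case (Suc k)
  have eq: "S (Suc k) \<omega> ^ 2 = S k \<omega> ^ 2 + 2 * (S k \<omega> ^ 1 * X k \<omega> ^ 1) + X k \<omega> ^ 2" for \<omega>
    by (simp add: S_def power2_eq_square algebra_simps)
  have "expectation (\<lambda>\<omega>. S (Suc k) \<omega> ^ 2)
      = expectation (\<lambda>\<omega>. S k \<omega> ^ 2) + 2 * (expectation (\<lambda>\<omega>. S k \<omega> ^ 1) * expectation (\<lambda>\<omega>. X k \<omega> ^ 1)) + expectation (\<lambda>\<omega>. X k \<omega> ^ 2)"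
    unfolding eq
    by (simp only: Bochner_Integration.integral_add Bochner_Integration.integrable_add
          integrable_S_X integrable_S integrable_X integrable_mult_right integral_mult_right_zero expectation_S_X)
  also have "\<dots> \<le> real k + 1"
    using Suc expectation_X_power_le[of k 2] by (simp add: mean)
  finally show ?case by simp
qed (simp add: S_def)

text \<open>In the binomial expansion the terms with a first power of \<open>X k\<close> or of
  \<open>S k\<close> vanish, as both have mean 0. What remains grows by at most
  \<open>6 * k + 1\<close> per step, below
  \<open>3 * (k + 1)^2 - 3 * k^2 = 6 * k + 3\<close>.\<close>

lemma fourth_moment_le: "expectation (\<lambda>\<omega>. S k \<omega> ^ 4) \<le> 3 * real k ^ 2"
proof (induction k)
  case (Suc k)
  have eq: "S (Suc k) \<omega> ^ 4 = S k \<omega> ^ 4 + 4 * (S k \<omega> ^ 3 * X k \<omega> ^ 1)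
      + 6 * (S k \<omega> ^ 2 * X k \<omega> ^ 2) + 4 * (S k \<omega> ^ 1 * X k \<omega> ^ 3) + X k \<omega> ^ 4" for \<omega>
    by (simp add: S_def power4_eq_xxxx power3_eq_cube power2_eq_square algebra_simps)
  have "expectation (\<lambda>\<omega>. S (Suc k) \<omega> ^ 4)
      = expectation (\<lambda>\<omega>. S k \<omega> ^ 4) + 4 * (expectation (\<lambda>\<omega>. S k \<omega> ^ 3) * expectation (\<lambda>\<omega>. X k \<omega> ^ 1))
        + 6 * (expectation (\<lambda>\<omega>. S k \<omega> ^ 2) * expectation (\<lambda>\<omega>. X k \<omega> ^ 2))
        + 4 * (expectation (\<lambda>\<omega>. S k \<omega> ^ 1) * expectation (\<lambda>\<omega>. X k \<omega> ^ 3)) + expectation (\<lambda>\<omega>. X k \<omega> ^ 4)"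
    unfolding eq
    by (simp only: Bochner_Integration.integral_add Bochner_Integration.integrable_add
          integrable_S_X integrable_S integrable_X integrable_mult_right integral_mult_right_zero expectation_S_X)
  also have "expectation (\<lambda>\<omega>. S k \<omega> ^ 2) * expectation (\<lambda>\<omega>. X k \<omega> ^ 2) \<le> real k * 1"
    by (intro mult_mono second_moment_le expectation_X_power_le integral_nonneg_AE) auto
  then have "expectation (\<lambda>\<omega>. S k \<omega> ^ 4) + 4 * (expectation (\<lambda>\<omega>. S k \<omega> ^ 3) * expectation (\<lambda>\<omega>. X k \<omega> ^ 1))
        + 6 * (expectation (\<lambda>\<omega>. S k \<omega> ^ 2) * expectation (\<lambda>\<omega>. X k \<omega> ^ 2))
        + 4 * (expectation (\<lambda>\<omega>. S k \<omega> ^ 1) * expectation (\<lambda>\<omega>. X k \<omega> ^ 3)) + expectation (\<lambda>\<omega>. X k \<omega> ^ 4)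
      \<le> 3 * real k ^ 2 + 6 * real k + 1"
    using Suc expectation_X_power_le[of k 4] by (simp add: mean expectation_S)
  also have "\<dots> \<le> 3 * real (Suc k) ^ 2"
    by (simp add: power2_eq_square algebra_simps)
  finally show ?case .
qed (simp add: S_def)

text \<open>The event that the walk first leaves the interval from \<open>-l\<close> to
  \<open>l\<close> at time \<open>k\<close>. These events split the maximal event disjointly, and
  each is determined by the steps before index \<open>k\<close>.\<close>

definition first_passage :: "real \<Rightarrow> nat \<Rightarrow> 'a set" where
  "first_passage l k = {\<omega> \<in> space M. l \<le> \<bar>S k \<omega>\<bar> \<and> (\<forall>i<k. \<bar>S i \<omega>\<bar> < l)}"

lemma first_passage_sets [measurable]: "first_passage l k \<in> sets M"
  unfolding first_passage_def by measurable

text \<open>The first factors depend on the steps below \<open>k\<close>, the increment on the steps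
  from \<open>k\<close> to \<open>L - 1\<close>. By independence the expectation factors, and the
  increment has mean 0.\<close>

lemma expectation_first_passage_increment:
  assumes "k \<le> L"
  shows "expectation (\<lambda>\<omega>. indicator (first_passage l k) \<omega> * S k \<omega> ^ 3 * (S L \<omega> - S k \<omega>)) = 0"
proof -
  define s where "s j x = (\<Sum>i<j. x i)" for j :: nat and x :: "nat \<Rightarrow> real"
  \<comment> \<open>\<open>g\<close> and \<open>h\<close> rewrite the two factors as functions of
    disjoint subfamilies of the steps, the form to which grouping of independent variables
    applies.\<close>
  define g where "g x = (if l \<le> \<bar>s k x\<bar> \<and> (\<forall>i<k. \<bar>s i x\<bar> < l) then s k x ^ 3 else 0)" for x
  define h where "h x = (\<Sum>i\<in>{k..<L}. x i)" for x :: "nat \<Rightarrow> real"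
  have s_meas: "s j \<in> borel_measurable (Pi\<^sub>M {..<k} (\<lambda>_. borel))" if "j \<le> k" for j
    unfolding s_def[abs_def] using that by (intro borel_measurable_sum measurable_component_singleton) auto
  have g_meas: "g \<in> borel_measurable (Pi\<^sub>M {..<k} (\<lambda>_. borel))"
    unfolding g_def[abs_def]
  proof (intro measurable_If borel_measurable_power s_meas borel_measurable_const)
    have "{x \<in> space (Pi\<^sub>M {..<k} (\<lambda>_. borel)). l \<le> \<bar>s k x\<bar> \<and> (\<forall>i\<in>{..<k}. \<bar>s i x\<bar> < l)} \<in> sets (Pi\<^sub>M {..<k} (\<lambda>_. borel))"
      by (intro sets.sets_Collect_conj sets.sets_Collect_finite_All borel_measurable_le borel_measurable_less
          borel_measurable_abs borel_measurable_const s_meas) auto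
    then show "{x \<in> space (Pi\<^sub>M {..<k} (\<lambda>_. borel)). l \<le> \<bar>s k x\<bar> \<and> (\<forall>i<k. \<bar>s i x\<bar> < l)} \<in> sets (Pi\<^sub>M {..<k} (\<lambda>_. borel))"
      by (simp only: Ball_def lessThan_iff)
  qed auto
  have h_meas: "h \<in> borel_measurable (Pi\<^sub>M {k..<L} (\<lambda>_. borel))"
    unfolding h_def[abs_def] by (intro borel_measurable_sum measurable_component_singleton) auto
  have ind: "indep_var borel (g \<circ> (\<lambda>\<omega>. \<lambda>i\<in>{..<k}. X i \<omega>)) borel (h \<circ> (\<lambda>\<omega>. \<lambda>i\<in>{k..<L}. X i \<omega>))"
    by (rule indep_var_compose[OF indep_var_restrict[OF indep] g_meas h_meas]) auto
  have s_eq: "s j (\<lambda>i\<in>{..<k}. X i \<omega>) = S j \<omega>" if "j \<le> k" for j \<omega>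
    unfolding s_def S_def using that by (intro sum.cong) auto
  have g_eq: "(g \<circ> (\<lambda>\<omega>. \<lambda>i\<in>{..<k}. X i \<omega>)) \<omega> = indicator (first_passage l k) \<omega> * S k \<omega> ^ 3"
    if "\<omega> \<in> space M" for \<omega>
    using that by (auto simp: g_def s_eq first_passage_def indicator_def)
  have h_eq: "(h \<circ> (\<lambda>\<omega>. \<lambda>i\<in>{k..<L}. X i \<omega>)) \<omega> = S L \<omega> - S k \<omega>" for \<omega>
    using sum_diff_nat_ivl[of 0 k L "\<lambda>i. X i \<omega>"] assms
    by (simp add: h_def S_def lessThan_atLeast0)
  have int_g: "integrable M (g \<circ> (\<lambda>\<omega>. \<lambda>i\<in>{..<k}. X i \<omega>))"
  proof (subst Bochner_Integration.integrable_cong[OF refl g_eq])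
    show "integrable M (\<lambda>\<omega>. indicator (first_passage l k) \<omega> * S k \<omega> ^ 3)"
      using integrable_S[of k 3] integrable_mult_indicator[of "first_passage l k" M "\<lambda>\<omega>. S k \<omega> ^ 3"] by simp
  qed
  have int_S: "integrable M (S j)" for j using integrable_S[of j 1] by simp
  have int_h: "integrable M (h \<circ> (\<lambda>\<omega>. \<lambda>i\<in>{k..<L}. X i \<omega>))"
    using int_S[of L] int_S[of k] by (subst Bochner_Integration.integrable_cong[OF refl h_eq]) auto
  have "expectation (h \<circ> (\<lambda>\<omega>. \<lambda>i\<in>{k..<L}. X i \<omega>)) = 0"
    using int_S[of L] int_S[of k] expectation_S
    by (subst Bochner_Integration.integral_cong[OF refl h_eq]) auto
  with indep_var_lebesgue_integral[OF ind int_g int_h]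
  have "expectation (\<lambda>\<omega>. (g \<circ> (\<lambda>\<omega>. \<lambda>i\<in>{..<k}. X i \<omega>)) \<omega> * (h \<circ> (\<lambda>\<omega>. \<lambda>i\<in>{k..<L}. X i \<omega>)) \<omega>) = 0"
    by (simp add: comp_def)
  also have "expectation (\<lambda>\<omega>. (g \<circ> (\<lambda>\<omega>. \<lambda>i\<in>{..<k}. X i \<omega>)) \<omega> * (h \<circ> (\<lambda>\<omega>. \<lambda>i\<in>{k..<L}. X i \<omega>)) \<omega>) =
      expectation (\<lambda>\<omega>. indicator (first_passage l k) \<omega> * S k \<omega> ^ 3 * (S L \<omega> - S k \<omega>))"
    by (intro Bochner_Integration.integral_cong refl) (simp only: g_eq h_eq)
  finally show ?thesis .
qed

text \<open>The convex function \<open>x ^ 4\<close> lies above its tangent at \<open>a\<close>.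
  With \<open>a = S k\<close> and \<open>b = S L\<close> the linear term averages to 0 over the
  first passage event.\<close>

lemma fourth_power_tangent: "(a::real) ^ 4 + 4 * (a ^ 3 * (b - a)) \<le> b ^ 4"
proof -
  have "b ^ 4 - (a ^ 4 + 4 * (a ^ 3 * (b - a))) = (b - a)\<^sup>2 * ((b + a)\<^sup>2 + 2 * a\<^sup>2)"
    by (simp add: power4_eq_xxxx power3_eq_cube power2_eq_square algebra_simps)
  also have "\<dots> \<ge> 0" by simp
  finally show ?thesis by simp
qed

text \<open>This is the submartingale property of \<open>S ^ 4\<close> at the first passage time:
  the tangent inequality lets \<open>S k\<close> be replaced by \<open>S L\<close> on the event,
  where \<open>S k ^ 4 \<ge> l ^ 4\<close>.\<close>

lemma first_passage_prob_le:
  assumes "k \<le> L" "l \<ge> 0"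
  shows "l ^ 4 * prob (first_passage l k) \<le> expectation (\<lambda>\<omega>. indicator (first_passage l k) \<omega> * S L \<omega> ^ 4)"
proof -
  let ?I = "indicator (first_passage l k) :: 'a \<Rightarrow> real"
  have int: "integrable M (\<lambda>\<omega>. ?I \<omega> * f \<omega>)" if "integrable M f" for f :: "'a \<Rightarrow> real"
    using integrable_mult_indicator[OF _ that, of "first_passage l k"] by simp
  have int3: "integrable M (\<lambda>\<omega>. S k \<omega> ^ 3 * (S L \<omega> - S k \<omega>))"
  proof (rule integrable_bounded)
    fix \<omega> assume \<omega>: "\<omega> \<in> space M"
    show "\<bar>S k \<omega> ^ 3 * (S L \<omega> - S k \<omega>)\<bar> \<le> real k ^ 3 * (real L + real k)"
      unfolding abs_mult power_abs using abs_S_le[OF \<omega>, of k] abs_S_le[OF \<omega>, of L]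
      by (intro mult_mono power_mono) auto
  qed measurable
  have "l ^ 4 * prob (first_passage l k) = expectation (\<lambda>\<omega>. ?I \<omega> * l ^ 4)"
    by (simp add: mult.commute)
  also have "\<dots> \<le> expectation (\<lambda>\<omega>. ?I \<omega> * S k \<omega> ^ 4)"
  proof (intro integral_mono int integrable_S)
    fix \<omega> assume "\<omega> \<in> space M"
    have "l ^ 4 \<le> \<bar>S k \<omega>\<bar> ^ 4" if "l \<le> \<bar>S k \<omega>\<bar>"
      using that assms by (intro power_mono) auto
    then show "?I \<omega> * l ^ 4 \<le> ?I \<omega> * S k \<omega> ^ 4"
      by (auto simp: indicator_def first_passage_def)
  qed auto
  also have "\<dots> = expectation (\<lambda>\<omega>. ?I \<omega> * S k \<omega> ^ 4) + 4 * expectation (\<lambda>\<omega>. ?I \<omega> * S k \<omega> ^ 3 * (S L \<omega> - S k \<omega>))"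
    using expectation_first_passage_increment[OF assms(1), of l] by simp
  also have "\<dots> = expectation (\<lambda>\<omega>. ?I \<omega> * S k \<omega> ^ 4 + 4 * (?I \<omega> * (S k \<omega> ^ 3 * (S L \<omega> - S k \<omega>))))"
    using int[OF integrable_S[of k 4]] int[OF int3] by (simp add: mult.assoc)
  also have "\<dots> \<le> expectation (\<lambda>\<omega>. ?I \<omega> * S L \<omega> ^ 4)"
  proof (intro integral_mono int integrable_S Bochner_Integration.integrable_add integrable_mult_right int3)
    fix \<omega>
    show "?I \<omega> * S k \<omega> ^ 4 + 4 * (?I \<omega> * (S k \<omega> ^ 3 * (S L \<omega> - S k \<omega>))) \<le> ?I \<omega> * S L \<omega> ^ 4"
      using fourth_power_tangent[of "S k \<omega>" "S L \<omega>"] by (auto simp: indicator_def)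
  qed
  finally show ?thesis .
qed

text \<open>The fourth moment is essential: over $m$ blocks of length $n/m$, a second moment bound at level
  $\eta\sqrt n$ would only sum to $O(1)$, whereas this one sums to $O(1/m)$.\<close>

lemma maximal_inequality:
  assumes "l > 0"
  shows "prob {\<omega> \<in> space M. \<exists>k\<le>L. l \<le> \<bar>S k \<omega>\<bar>} \<le> 3 * real L ^ 2 / l ^ 4"
proof -
  have disj: "disjoint_family_on (first_passage l) {..L}"
  proof (unfold disjoint_family_on_def, intro ballI impI)
    fix i j :: nat assume "i \<noteq> j"
    then show "first_passage l i \<inter> first_passage l j = {}"
      by (cases "i < j") (auto simp: first_passage_def not_less dest!: le_neq_implies_less)
  qed
  have un: "{\<omega> \<in> space M. \<exists>k\<le>L. l \<le> \<bar>S k \<omega>\<bar>} = (\<Union>k\<in>{..L}. first_passage l k)"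
  proof (intro equalityI subsetI)
    fix \<omega> assume "\<omega> \<in> {\<omega> \<in> space M. \<exists>k\<le>L. l \<le> \<bar>S k \<omega>\<bar>}"
    then obtain k where k: "\<omega> \<in> space M" "k \<le> L" "l \<le> \<bar>S k \<omega>\<bar>" by auto
    define k0 where "k0 = (LEAST k. l \<le> \<bar>S k \<omega>\<bar>)"
    have "l \<le> \<bar>S k0 \<omega>\<bar>" unfolding k0_def using k(3) by (rule LeastI)
    moreover have "k0 \<le> k" unfolding k0_def using k(3) by (rule Least_le)
    moreover have "\<bar>S i \<omega>\<bar> < l" if "i < k0" for i
      using not_less_Least[OF that[unfolded k0_def]] by simp
    ultimately have "\<omega> \<in> first_passage l k0" "k0 \<le> L" using k by (auto simp: first_passage_def)
    then show "\<omega> \<in> (\<Union>k\<in>{..L}. first_passage l k)" by auto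
  qed (auto simp: first_passage_def)
  \<comment> \<open>Since the events are disjoint, their indicators add up again to a single
    indicator, which is at most 1.\<close>
  have "l ^ 4 * prob (\<Union>k\<in>{..L}. first_passage l k) = (\<Sum>k\<le>L. l ^ 4 * prob (first_passage l k))"
    by (subst finite_measure_finite_Union[OF _ _ disj]) (auto simp: sum_distrib_left)
  also have "\<dots> \<le> (\<Sum>k\<le>L. expectation (\<lambda>\<omega>. indicator (first_passage l k) \<omega> * S L \<omega> ^ 4))"
    using assms by (intro sum_mono first_passage_prob_le) auto
  also have "\<dots> = expectation (\<lambda>\<omega>. \<Sum>k\<le>L. indicator (first_passage l k) \<omega> * S L \<omega> ^ 4)"
    using integrable_mult_indicator[OF _ integrable_S[of L 4], of "first_passage l _"]
    by (subst Bochner_Integration.integral_sum) auto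
  also have "\<dots> = expectation (\<lambda>\<omega>. indicator (\<Union>k\<in>{..L}. first_passage l k) \<omega> * S L \<omega> ^ 4)"
    by (simp add: sum_distrib_right[symmetric] indicator_UN_disjoint[OF _ disj])
  also have "\<dots> \<le> expectation (\<lambda>\<omega>. S L \<omega> ^ 4)"
    using integrable_mult_indicator[OF _ integrable_S[of L 4], of "\<Union>k\<in>{..L}. first_passage l k"]
    by (intro integral_mono integrable_S) (auto simp: indicator_def)
  also have "\<dots> \<le> 3 * real L ^ 2" by (rule fourth_moment_le)
  finally show ?thesis using assms by (simp add: un field_simps)
qed

end

section \<open>Sequences of independent uniform variables\<close>

text \<open>The half-open interval is the range of \<open>frac\<close>, and on it integer parts are
  0 everywhere. Identities between floors and descents then hold at every sample point, without
  exceptional null sets.\<close>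

definition unif :: "real measure" where
  "unif = restrict_space lborel {0..<1}"

text \<open>A single infinite sequence carries the walks of all lengths, so the space does not
  change with \<open>n\<close>.\<close>

definition unif_seq :: "(nat \<Rightarrow> real) measure" where
  "unif_seq = Pi\<^sub>M UNIV (\<lambda>_. unif)"

lemma space_unif [simp]: "space unif = {0..<1}"
  by (simp add: unif_def space_restrict_space)

lemma measurable_unif_borel: "f \<in> borel_measurable borel \<Longrightarrow> f \<in> borel_measurable unif"
  unfolding unif_def by (intro measurable_restrict_space1) simp

lemma measurable_into_unif:
  assumes "f \<in> borel_measurable M" "\<And>x. x \<in> space M \<Longrightarrow> f x \<in> {0..<1}"
  shows "f \<in> measurable M unif"
  unfolding unif_def using assms by (intro measurable_restrict_space2) auto

lemma prob_space_unif: "prob_space unif"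
  by (rule prob_spaceI) (simp add: unif_def emeasure_restrict_space space_restrict_space)

interpretation unif: prob_space unif by (rule prob_space_unif)

interpretation unif_product: product_prob_space "\<lambda>_. unif" I for I :: "nat set"
  by unfold_locales

interpretation unif_seq: prob_space unif_seq
  unfolding unif_seq_def by (rule prob_space_PiM) (rule prob_space_unif)

lemma space_unif_seq: "\<omega> \<in> space unif_seq \<longleftrightarrow> (\<forall>i. \<omega> i \<in> {0..<1})"
  by (auto simp: unif_seq_def space_PiM PiE_iff)

lemma measurable_coordinate_unif_seq: "(\<lambda>\<omega>. \<omega> i) \<in> measurable unif_seq unif"
  unfolding unif_seq_def by (rule measurable_component_singleton) simp

lemma measurable_coordinate_unif_seq_borel: "(\<lambda>\<omega>. \<omega> i) \<in> borel_measurable unif_seq"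
  by (rule measurable_compose[OF measurable_coordinate_unif_seq]) (rule measurable_unif_borel, simp)

lemma distr_coordinate_unif_seq: "distr unif_seq unif (\<lambda>\<omega>. \<omega> i) = unif"
  unfolding unif_seq_def by (rule distr_PiM_component) (auto intro: prob_space_unif)

lemma indep_vars_unif_seq: "unif_seq.indep_vars (\<lambda>_. unif) (\<lambda>i \<omega>. \<omega> i) UNIV"
proof (subst unif_seq.indep_vars_iff_distr_eq_PiM')
  show "distr unif_seq (Pi\<^sub>M UNIV (\<lambda>i. unif)) (\<lambda>x. \<lambda>i\<in>UNIV. x i) =
      Pi\<^sub>M UNIV (\<lambda>i. distr unif_seq unif (\<lambda>\<omega>. \<omega> i))"
    unfolding distr_coordinate_unif_seq by (simp add: unif_seq_def restrict_UNIV distr_id2)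
qed (auto intro: measurable_coordinate_unif_seq)

text \<open>An injective reindexing of an i.i.d. sequence preserves its law. This moves statements
  about the initial segment of the walk to the block that starts at \<open>j * L\<close>.\<close>

lemma distr_shift_unif_seq: "distr unif_seq unif_seq (\<lambda>\<omega> i. \<omega> (a + i)) = unif_seq"
  using distr_PiM_reindex[of UNIV "\<lambda>_. unif" "\<lambda>i. a + i" UNIV]
  by (simp add: prob_space_unif unif_seq_def restrict_UNIV)

text \<open>The sign makes twice the partial sums of \<open>cent\<close> the approximation of the descent path.\<close>

definition cent :: "nat \<Rightarrow> (nat \<Rightarrow> real) \<Rightarrow> real" where
  "cent i \<omega> = 1 / 2 - \<omega> i"

lemma cent_measurable [measurable]: "cent i \<in> borel_measurable unif_seq"
  unfolding cent_def[abs_def]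
  by (intro borel_measurable_diff borel_measurable_const measurable_coordinate_unif_seq_borel)

lemma indep_vars_cent: "unif_seq.indep_vars (\<lambda>_. borel) cent UNIV"
  using unif_seq.indep_vars_compose2[OF indep_vars_unif_seq, of "\<lambda>_ x. 1 / 2 - x" "\<lambda>_. borel"]
  by (simp add: cent_def[abs_def] measurable_unif_borel)

lemma distr_cent: "distr unif_seq borel (cent i) = distr unif borel (\<lambda>x. 1 / 2 - x)"
proof -
  have "distr unif borel (\<lambda>x. 1 / 2 - x) = distr (distr unif_seq unif (\<lambda>\<omega>. \<omega> i)) borel (\<lambda>x. 1 / 2 - x)"
    by (simp add: distr_coordinate_unif_seq)
  also have "\<dots> = distr unif_seq borel (cent i)"
    by (subst distr_distr) (auto simp: comp_def cent_def[abs_def] measurable_unif_borel measurable_coordinate_unif_seq)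
  finally show ?thesis ..
qed

lemma integral_unif:
  assumes [measurable]: "f \<in> borel_measurable borel"
    and "continuous_on {0..1} f" "\<And>x. x \<in> {0..1} \<Longrightarrow> (G has_real_derivative f x) (at x within {0..1})"
  shows "(\<integral>x. f x \<partial>unif) = G 1 - G 0"
proof -
  have "(\<integral>x. f x \<partial>unif) = (\<integral>x. indicator {0..<1} x *\<^sub>R f x \<partial>lborel)"
    unfolding unif_def by (subst integral_restrict_space) auto
  \<comment> \<open>The endpoint 1 is a null set, and the fundamental theorem is stated for the
    closed interval.\<close>
  also have "\<dots> = (\<integral>x. indicator {0..1} x *\<^sub>R f x \<partial>lborel)"
    using AE_lborel_singleton[of "1::real"]
    by (intro integral_cong_AE) (auto simp: indicator_def)
  also have "\<dots> = G 1 - G 0"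
    using assms by (intro integral_FTC_Icc) (auto simp: has_real_derivative_iff_has_vector_derivative)
  finally show ?thesis .
qed

lemma expectation_comp_cent:
  fixes f :: "real \<Rightarrow> real"
  assumes [measurable]: "f \<in> borel_measurable borel"
  shows "unif_seq.expectation (\<lambda>\<omega>. f (cent i \<omega>)) = (\<integral>x. f (1 / 2 - x) \<partial>unif)"
proof -
  have "unif_seq.expectation (\<lambda>\<omega>. f (cent i \<omega>)) = (\<integral>x. f x \<partial>distr unif_seq borel (cent i))"
    by (rule integral_distr[symmetric]) auto
  also have "\<dots> = (\<integral>x. f (1 / 2 - x) \<partial>unif)"
    unfolding distr_cent by (subst integral_distr) (auto simp: measurable_unif_borel)
  finally show ?thesis .
qed

lemma expectation_cent: "unif_seq.expectation (cent i) = 0"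
proof -
  have "(\<integral>x. 1 / 2 - x \<partial>unif) = (\<lambda>x. x / 2 - x ^ 2 / 2) 1 - (\<lambda>x. x / 2 - x ^ 2 / 2) (0::real)"
    by (rule integral_unif) (auto intro!: continuous_intros derivative_eq_intros)
  with expectation_comp_cent[of "\<lambda>x. x" i] show ?thesis by simp
qed

text \<open>The origin of the factor \<open>1 / sqrt 3\<close>: the walk has steps
  \<open>2 * cent i\<close>, of variance \<open>4 / 12\<close>.\<close>

lemma variance_cent: "unif_seq.variance (cent i) = 1 / 12"
proof -
  have "(\<integral>x. (1 / 2 - x) ^ 2 \<partial>unif) = (\<lambda>x. - ((1 / 2 - x) ^ 3 / 3)) 1 - (\<lambda>x. - ((1 / 2 - x) ^ 3 / 3)) (0::real)"
    by (rule integral_unif) (auto intro!: continuous_intros derivative_eq_intros)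
  with expectation_comp_cent[of "\<lambda>x. x ^ 2" i] show ?thesis
    by (simp add: expectation_cent power3_eq_cube)
qed

interpretation cent: bounded_centered_sequence unif_seq cent
proof
  show "\<bar>cent i \<omega>\<bar> \<le> 1" if "\<omega> \<in> space unif_seq" for i \<omega>
    using that by (auto simp: space_unif_seq cent_def abs_le_iff dest: spec[of _ i])
qed (rule indep_vars_cent expectation_cent)+

section \<open>Convergence of block increments\<close>

lemma measurable_compose_coordinate:
  assumes "Y \<in> measurable N L" "j \<in> I"
  shows "(\<lambda>\<omega>. Y (\<omega> j)) \<in> measurable (Pi\<^sub>M I (\<lambda>_. N)) L"
proof -
  have "(\<lambda>\<omega>. \<omega> j) \<in> measurable (Pi\<^sub>M I (\<lambda>_. N)) N"
    using assms(2) by (rule measurable_component_singleton)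
  then show ?thesis using assms(1) by (rule measurable_compose)
qed

text \<open>Independence and the marginals determine the joint law, so the vector can be realised on
  \<open>m\<close> copies of any space that carries one variable of the common law. Thus a
  one-dimensional Skorohod representation suffices for vectors of block increments.\<close>

lemma expectation_indep_eq_product:
  fixes X :: "nat \<Rightarrow> 'a \<Rightarrow> real" and Y :: "'b \<Rightarrow> real" and G :: "(nat \<Rightarrow> real) \<Rightarrow> real"
  assumes M: "prob_space M" and N: "prob_space N" and m: "m > 0"
    and indep: "prob_space.indep_vars M (\<lambda>_. borel) X {..<m}"
    and Y: "Y \<in> borel_measurable N"
    and law: "\<And>j. j < m \<Longrightarrow> distr M borel (X j) = distr N borel Y"
    and G: "G \<in> borel_measurable (Pi\<^sub>M {..<m} (\<lambda>_. borel))"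
  shows "(\<integral>\<omega>. G (\<lambda>j\<in>{..<m}. X j \<omega>) \<partial>M) = (\<integral>\<omega>. G (\<lambda>j\<in>{..<m}. Y (\<omega> j)) \<partial>Pi\<^sub>M {..<m} (\<lambda>_. N))"
proof -
  interpret M: prob_space M by fact
  interpret N: prob_space N by fact
  let ?P = "Pi\<^sub>M {..<m} (\<lambda>_. borel) :: (nat \<Rightarrow> real) measure"
  let ?Y = "\<lambda>\<omega>. \<lambda>j\<in>{..<m}. Y (\<omega> j)"
  have X: "X j \<in> borel_measurable M" if "j < m" for j
    using indep that by (auto simp: M.indep_vars_def)
  have X': "(\<lambda>\<omega>. \<lambda>j\<in>{..<m}. X j \<omega>) \<in> measurable M ?P"
    by (intro measurable_restrict) (auto simp: X)
  have Y': "?Y \<in> measurable (Pi\<^sub>M {..<m} (\<lambda>_. N)) ?P"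
    by (intro measurable_restrict measurable_compose_coordinate[OF Y]) auto
  have "distr M ?P (\<lambda>\<omega>. \<lambda>j\<in>{..<m}. X j \<omega>) = Pi\<^sub>M {..<m} (\<lambda>j. distr M borel (X j))"
    using m indep X by (subst M.indep_vars_iff_distr_eq_PiM'[symmetric]) auto
  also have "\<dots> = Pi\<^sub>M {..<m} (\<lambda>j. distr N borel Y)"
    by (intro PiM_cong) (auto simp: law)
  also have "\<dots> = distr (Pi\<^sub>M {..<m} (\<lambda>_. N)) (Pi\<^sub>M {..<m} (\<lambda>_. distr N borel Y)) (compose {..<m} Y)"
    by (subst distr_PiM_finite_prob_space') (auto simp: N N.prob_space_distr Y intro!: PiM_cong distr_cong)
  also have "\<dots> = distr (Pi\<^sub>M {..<m} (\<lambda>_. N)) ?P ?Y"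
    by (intro distr_cong sets_PiM_cong) (auto simp: compose_def)
  finally have eq: "distr M ?P (\<lambda>\<omega>. \<lambda>j\<in>{..<m}. X j \<omega>) = distr (Pi\<^sub>M {..<m} (\<lambda>_. N)) ?P ?Y" .
  show ?thesis
    using arg_cong[OF eq, of "\<lambda>Q. integral\<^sup>L Q G"] by (simp add: integral_distr[OF X' G] integral_distr[OF Y' G])
qed

lemma expectation_bcf_poly_path_indep:
  fixes X :: "nat \<Rightarrow> 'a \<Rightarrow> real" and Y :: "'b \<Rightarrow> real"
  assumes "prob_space M" "prob_space N" "m > 0"
    and "prob_space.indep_vars M (\<lambda>_. borel) X {..<m}" "Y \<in> borel_measurable N"
    and "\<And>j. j < m \<Longrightarrow> distr M borel (X j) = distr N borel Y"
    and F: "bounded_continuous_functional_C01 F"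
  shows "(\<integral>\<omega>. F (poly_path m (\<lambda>j. X j \<omega>)) \<partial>M)
    = (\<integral>\<omega>. F (poly_path m (\<lambda>j. Y (\<omega> j))) \<partial>Pi\<^sub>M {..<m} (\<lambda>_. N))"
proof -
  have "(\<lambda>x. F (poly_path m x)) \<in> borel_measurable (Pi\<^sub>M {..<m} (\<lambda>_. borel))"
    by (rule measurable_bcf_poly_path[OF F]) (auto intro!: measurable_component_singleton)
  from expectation_indep_eq_product[OF assms(1-6) this] show ?thesis
    by (simp cong: poly_path_cong)
qed

lemma cent_clt:
  "weak_conv_m (\<lambda>n. distr unif_seq borel (\<lambda>\<omega>. cent.S n \<omega> / sqrt (real n / 12))) std_normal_distribution"
proof -
  have second_moment: "unif_seq.expectation (\<lambda>\<omega>. (cent i \<omega>)\<^sup>2) = 1 / 12" for i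
    using variance_cent[of i] by (simp add: expectation_cent)
  have "weak_conv_m (\<lambda>n. distr unif_seq borel (\<lambda>\<omega>. (\<Sum>i<n. cent i \<omega>) / sqrt (real n * (sqrt (1 / 12))\<^sup>2))) std_normal_distribution"
    by (rule unif_seq.central_limit_theorem_zero_mean)
       (auto simp: indep_vars_cent expectation_cent second_moment distr_cent cent.integrable_X)
  then show ?thesis by (simp add: cent.S_def[abs_def])
qed

text \<open>With \<open>L = n div m\<close> the \<open>m\<close> blocks have equal length, hence
  equal law. The fewer than \<open>m\<close> leftover steps are dropped, and the error estimate for
  paths accounts for them.\<close>

definition block :: "nat \<Rightarrow> nat \<Rightarrow> (nat \<Rightarrow> real) \<Rightarrow> real" where
  "block L j \<omega> = (\<Sum>i<L. cent (j * L + i) \<omega>)"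

lemma block_measurable [measurable]: "block L j \<in> borel_measurable unif_seq"
  unfolding block_def[abs_def] by measurable

lemma block_eq_S_shift: "block L j \<omega> = cent.S L (\<lambda>i. \<omega> (j * L + i))"
  by (simp add: block_def cent.S_def cent_def)

lemma measurable_shift_unif_seq: "(\<lambda>\<omega> i. \<omega> (a + i)) \<in> measurable unif_seq unif_seq"
  by (subst (2) unif_seq_def, rule measurable_PiM_single')
     (auto simp: measurable_coordinate_unif_seq space_unif_seq PiE_iff)

lemma distr_block: "distr unif_seq borel (block L j) = distr unif_seq borel (cent.S L)"
proof -
  have "distr unif_seq borel (cent.S L) = distr (distr unif_seq unif_seq (\<lambda>\<omega> i. \<omega> (j * L + i))) borel (cent.S L)"
    by (simp add: distr_shift_unif_seq)
  also have "\<dots> = distr unif_seq borel (block L j)"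
    by (subst distr_distr) (auto simp: measurable_shift_unif_seq comp_def block_eq_S_shift[abs_def])
  finally show ?thesis ..
qed

text \<open>Different blocks use disjoint ranges of indices.\<close>

lemma indep_vars_block: "unif_seq.indep_vars (\<lambda>_. borel) (block L) UNIV"
proof -
  let ?K = "\<lambda>j::nat. {j * L..<j * L + L}"
  have disj: "disjoint_family_on ?K UNIV"
  proof (unfold disjoint_family_on_def, intro ballI impI)
    fix i j :: nat assume "i \<noteq> j"
    then have "Suc i * L \<le> j * L \<or> Suc j * L \<le> i * L"
      by (metis Suc_leI linorder_neqE_nat mult_le_mono1)
    then show "?K i \<inter> ?K j = {}" by auto
  qed
  have "unif_seq.indep_vars (\<lambda>j. Pi\<^sub>M (?K j) (\<lambda>_. borel)) (\<lambda>j \<omega>. \<lambda>i\<in>?K j. cent i \<omega>) UNIV"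
    by (rule unif_seq.indep_vars_restrict[OF indep_vars_cent _ disj]) auto
  then have "unif_seq.indep_vars (\<lambda>_. borel) (\<lambda>j \<omega>. \<Sum>i\<in>?K j. (\<lambda>i\<in>?K j. cent i \<omega>) i) UNIV"
    by (rule unif_seq.indep_vars_compose2[where Y = "\<lambda>j x. \<Sum>i\<in>?K j. x i"])
       (auto intro!: borel_measurable_sum measurable_component_singleton)
  moreover have "(\<Sum>i\<in>?K j. (\<lambda>i\<in>?K j. cent i \<omega>) i) = block L j \<omega>" for j \<omega>
    using sum.shift_bounds_nat_ivl[of "\<lambda>i. cent i \<omega>" 0 "j * L" L]
    by (simp add: block_def lessThan_atLeast0 add.commute)
  ultimately show ?thesis by (simp add: fun_eq_iff[symmetric] cong: if_cong)
qed

lemma div_over_tendsto: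
  assumes "m > 0"
  shows "(\<lambda>n. real (n div m) / real n) \<longlonglongrightarrow> 1 / real m"
proof (rule real_tendsto_sandwich)
  show "eventually (\<lambda>n. 1 / real m - 1 / real n \<le> real (n div m) / real n) sequentially"
    using eventually_gt_at_top[of 0]
  proof eventually_elim
    case (elim n)
    have "n < m * (n div m) + m" using assms
      by (metis add.commute mod_less_divisor mult_div_mod_eq nat_add_left_cancel_less)
    then have "real n \<le> real m * (real (n div m) + 1)"
      by (metis (mono_tags, opaque_lifting) distrib_left less_imp_le mult.right_neutral of_nat_add of_nat_le_iff of_nat_mult)
    then have "(real n / real m - 1) / real n \<le> real (n div m) / real n"
      using assms by (intro divide_right_mono) (auto simp: field_simps)
    then show ?case using elim by (simp add: diff_divide_distrib)
  qed
  show "eventually (\<lambda>n. real (n div m) / real n \<le> 1 / real m) sequentially"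
    using eventually_gt_at_top[of 0]
  proof eventually_elim
    case (elim n)
    have "real m * real (n div m) \<le> real n"
      by (metis of_nat_le_iff of_nat_mult times_div_less_eq_dividend)
    then show ?case using assms elim by (simp add: field_simps)
  qed
  show "(\<lambda>n. 1 / real m - 1 / real n) \<longlonglongrightarrow> 1 / real m"
    using tendsto_diff[OF tendsto_const lim_1_over_n, of "1 / real m"] by simp
qed simp

text \<open>Both sides are rewritten as expectations over one product space, on which the increments
  converge pointwise. Continuity of \<open>F\<close> then gives pointwise convergence of the
  integrands, and boundedness of \<open>F\<close> gives dominated convergence.\<close>

lemma block_path_limit:
  fixes M :: "'a measure"
  assumes M: "prob_space M" and m: "m > 0"
    and indep: "prob_space.indep_vars M (\<lambda>_. borel) Z {..<m}"
    and law: "\<And>j. j < m \<Longrightarrow> distributed M lborel (Z j) (normal_density 0 (1 / sqrt (3 * real m)))"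
    and F: "bounded_continuous_functional_C01 F"
  shows "(\<lambda>n. \<integral>\<omega>. F (poly_path m (\<lambda>j. 2 * block (n div m) j \<omega> / sqrt (real n))) \<partial>unif_seq)
    \<longlonglongrightarrow> (\<integral>\<omega>. F (poly_path m (\<lambda>j. Z j \<omega>)) \<partial>M)"
proof -
  have "\<exists> (\<Omega> :: real measure) (Y_seq :: nat \<Rightarrow> real \<Rightarrow> real) (Y :: real \<Rightarrow> real).
    prob_space \<Omega> \<and>
    (\<forall>n. Y_seq n \<in> measurable \<Omega> borel) \<and>
    (\<forall>n. distr \<Omega> borel (Y_seq n) = distr unif_seq borel (\<lambda>\<omega>. cent.S n \<omega> / sqrt (real n / 12))) \<and>
    Y \<in> measurable \<Omega> lborel \<and>
    distr \<Omega> borel Y = std_normal_distribution \<and>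
    (\<forall>x \<in> space \<Omega>. (\<lambda>n. Y_seq n x) \<longlonglongrightarrow> Y x)"
    by (rule Skorohod[OF _ _ cent_clt]) (auto simp: real_dist_normal_dist)
  then obtain \<Omega> :: "real measure" and W :: "nat \<Rightarrow> real \<Rightarrow> real" and Y :: "real \<Rightarrow> real"
    where \<Omega>: "prob_space \<Omega>" and W': "\<forall>n. W n \<in> borel_measurable \<Omega>"
      and lawW': "\<forall>n. distr \<Omega> borel (W n) = distr unif_seq borel (\<lambda>\<omega>. cent.S n \<omega> / sqrt (real n / 12))"
      and Y': "Y \<in> measurable \<Omega> lborel" and lawY: "distr \<Omega> borel Y = std_normal_distribution"
      and lim': "\<forall>x\<in>space \<Omega>. (\<lambda>n. W n x) \<longlonglongrightarrow> Y x"
    by blast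
  note W = W'[rule_format] and lawW = lawW'[rule_format] and lim = lim'[rule_format]
  have Y: "Y \<in> borel_measurable \<Omega>" using Y' by simp
  interpret \<Omega>: prob_space \<Omega> by fact
  interpret M: prob_space M by fact
  \<comment> \<open>\<open>c n\<close> converts the normalization \<open>sqrt (L / 12)\<close> of
    the central limit theorem, with \<open>L = n div m\<close>, into the factor
    \<open>2 / sqrt n\<close> of the path. Since \<open>L / n\<close> tends to \<open>1 / m\<close>,
    it converges to \<open>1 / sqrt (3 * m)\<close>, the standard deviation of one limiting
    increment.\<close>
  define c where "c n = 2 * sqrt (real (n div m) / 12) / sqrt (real n)" for n
  have c_eq: "c n = sqrt (real (n div m) / real n / 3)" for n
  proof -
    have "c n = sqrt 4 * sqrt (real (n div m) / 12) / sqrt (real n)" by (simp add: c_def)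
    also have "\<dots> = sqrt (4 * (real (n div m) / 12) / real n)"
      by (simp only: real_sqrt_mult real_sqrt_divide)
    finally show ?thesis by (simp add: mult.commute)
  qed
  have "(\<lambda>n. sqrt (real (n div m) / real n / 3)) \<longlonglongrightarrow> sqrt (1 / real m / 3)"
    by (intro tendsto_intros div_over_tendsto m) auto
  then have c_lim: "c \<longlonglongrightarrow> 1 / sqrt (3 * real m)"
    by (simp add: c_eq[abs_def] real_sqrt_divide real_sqrt_mult mult.commute)
  let ?Q = "Pi\<^sub>M {..<m} (\<lambda>_::nat. \<Omega>)"
  interpret Q: prob_space ?Q by (rule prob_space_PiM) (rule \<Omega>)
  have pre: "(\<integral>\<omega>. F (poly_path m (\<lambda>j. 2 * block (n div m) j \<omega> / sqrt (real n))) \<partial>unif_seq)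
      = (\<integral>\<omega>. F (poly_path m (\<lambda>j. c n * W (n div m) (\<omega> j))) \<partial>?Q)" for n
  proof (rule expectation_bcf_poly_path_indep[OF unif_seq.prob_space_axioms \<Omega> m _ _ _ F])
    let ?L = "n div m"
    show "unif_seq.indep_vars (\<lambda>_. borel) (\<lambda>j \<omega>. 2 * block ?L j \<omega> / sqrt (real n)) {..<m}"
      by (rule unif_seq.indep_vars_compose2[OF unif_seq.indep_vars_subset[OF indep_vars_block]]) auto
    show "(\<lambda>x. c n * W ?L x) \<in> borel_measurable \<Omega>" using W by simp
    \<comment> \<open>For \<open>?L = 0\<close> the normalization divides by 0, but both sides are
      then 0.\<close>
    have Sc: "2 * cent.S ?L \<omega> / sqrt (real n) = c n * (cent.S ?L \<omega> / sqrt (real ?L / 12))" for \<omega>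
      by (cases "?L = 0") (auto simp: c_def cent.S_def)
    fix j
    have "distr unif_seq borel (\<lambda>\<omega>. 2 * block ?L j \<omega> / sqrt (real n))
        = distr (distr unif_seq borel (block ?L j)) borel (\<lambda>x. 2 * x / sqrt (real n))"
      by (subst distr_distr) (auto simp: comp_def)
    also have "\<dots> = distr unif_seq borel (\<lambda>\<omega>. 2 * cent.S ?L \<omega> / sqrt (real n))"
      unfolding distr_block by (subst distr_distr) (auto simp: comp_def)
    also have "\<dots> = distr (distr unif_seq borel (\<lambda>\<omega>. cent.S ?L \<omega> / sqrt (real ?L / 12))) borel (\<lambda>x. c n * x)"
      unfolding Sc by (subst distr_distr) (auto simp: comp_def)
    also have "\<dots> = distr \<Omega> borel (\<lambda>x. c n * W ?L x)"
      unfolding lawW[symmetric] using W by (subst distr_distr) (auto simp: comp_def)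
    finally show "distr unif_seq borel (\<lambda>\<omega>. 2 * block ?L j \<omega> / sqrt (real n)) = distr \<Omega> borel (\<lambda>x. c n * W ?L x)" .
  qed
  have post: "(\<integral>\<omega>. F (poly_path m (\<lambda>j. Z j \<omega>)) \<partial>M)
      = (\<integral>\<omega>. F (poly_path m (\<lambda>j. 1 / sqrt (3 * real m) * Y (\<omega> j))) \<partial>?Q)"
  proof (rule expectation_bcf_poly_path_indep[OF M \<Omega> m indep _ _ F])
    show "(\<lambda>x. 1 / sqrt (3 * real m) * Y x) \<in> borel_measurable \<Omega>" using Y by simp
    have "distributed \<Omega> lborel Y (normal_density 0 1)"
      unfolding distributed_def using lawY Y by (simp cong: distr_cong)
    then have d: "distributed \<Omega> lborel (\<lambda>x. 0 + 1 / sqrt (3 * real m) * Y x)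
        (normal_density (0 + 1 / sqrt (3 * real m) * 0) (\<bar>1 / sqrt (3 * real m)\<bar> * 1))"
      using m by (intro \<Omega>.normal_density_affine) auto
    fix j assume "j < m"
    from distributed_distr_eq_density[OF law[OF this]] distributed_distr_eq_density[OF d]
    have "distr M lborel (Z j) = distr \<Omega> lborel (\<lambda>x. 1 / sqrt (3 * real m) * Y x)" by simp
    then show "distr M borel (Z j) = distr \<Omega> borel (\<lambda>x. 1 / sqrt (3 * real m) * Y x)"
      by (simp cong: distr_cong)
  qed
  obtain C where C: "\<And>g. continuous_on {0..1} g \<Longrightarrow> \<bar>F g\<bar> \<le> C"
    using F unfolding bounded_continuous_functional_C01_def by blast
  show ?thesis
    unfolding pre post
  proof (rule integral_dominated_convergence[where w = "\<lambda>_. C"])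
    show "(\<lambda>\<omega>. F (poly_path m (\<lambda>j. 1 / sqrt (3 * real m) * Y (\<omega> j)))) \<in> borel_measurable ?Q"
      by (intro measurable_bcf_poly_path[OF F] borel_measurable_times borel_measurable_const
          measurable_compose_coordinate[OF Y]) auto
    show "(\<lambda>\<omega>. F (poly_path m (\<lambda>j. c n * W (n div m) (\<omega> j)))) \<in> borel_measurable ?Q" for n
      by (intro measurable_bcf_poly_path[OF F] borel_measurable_times borel_measurable_const
          measurable_compose_coordinate[OF W]) auto
    show "AE \<omega> in ?Q. (\<lambda>n. F (poly_path m (\<lambda>j. c n * W (n div m) (\<omega> j))))
        \<longlonglongrightarrow> F (poly_path m (\<lambda>j. 1 / sqrt (3 * real m) * Y (\<omega> j)))"
    proof (rule AE_I2)
      fix \<omega> assume \<omega>: "\<omega> \<in> space ?Q"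
      have "filterlim (\<lambda>n. n div m) sequentially sequentially"
        using m by (simp add: filterlim_at_top_div_const_nat)
      then have "(\<lambda>n. c n * W (n div m) (\<omega> j)) \<longlonglongrightarrow> 1 / sqrt (3 * real m) * Y (\<omega> j)" if "j < m" for j
        using that \<omega> by (intro tendsto_mult c_lim filterlim_compose[OF lim]) (auto simp: space_PiM PiE_iff)
      then have "(\<lambda>n. \<Sum>j<m. \<bar>c n * W (n div m) (\<omega> j) - 1 / sqrt (3 * real m) * Y (\<omega> j)\<bar>)
          \<longlonglongrightarrow> (\<Sum>j<m. \<bar>1 / sqrt (3 * real m) * Y (\<omega> j) - 1 / sqrt (3 * real m) * Y (\<omega> j)\<bar>)"
        by (intro tendsto_sum tendsto_rabs tendsto_diff tendsto_const) auto
      then have "(\<lambda>n. \<Sum>j<m. \<bar>c n * W (n div m) (\<omega> j) - 1 / sqrt (3 * real m) * Y (\<omega> j)\<bar>) \<longlonglongrightarrow> 0"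
        by simp
      then show "(\<lambda>n. F (poly_path m (\<lambda>j. c n * W (n div m) (\<omega> j))))
        \<longlonglongrightarrow> F (poly_path m (\<lambda>j. 1 / sqrt (3 * real m) * Y (\<omega> j)))"
        by (rule bcf_tendsto[OF F continuous_on_poly_path continuous_on_poly_path abs_poly_path_diff_le])
    qed
  qed (auto simp: C continuous_on_poly_path)
qed

section \<open>Descents of uniform permutations\<close>

text \<open>A rotation of the circle preserves the uniform law. It cuts the interval into two
  pieces, and each piece is translated.\<close>

lemma nn_integral_unif_frac_shift:
  assumes f: "f \<in> borel_measurable unif"
  shows "(\<integral>\<^sup>+y. f (frac (a + y)) \<partial>unif) = (\<integral>\<^sup>+y. f y \<partial>unif)"
proof -
  define c where "c = frac a"
  have c: "0 \<le> c" "c < 1" by (auto simp: c_def frac_lt_1)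
  \<comment> \<open>Extension by 0 gives a Borel function on the line, as needed for translation
    under \<open>lborel\<close>.\<close>
  define g where "g z = f z * indicator {0..<1} z" for z
  have [measurable]: "g \<in> borel_measurable borel"
    using f unfolding g_def[abs_def] unif_def
    by (subst (asm) borel_measurable_restrict_space_iff_ennreal) auto
  have shift: "frac (a + y) = (if y < 1 - c then c + y else c - 1 + y)" if "y \<in> {0..<1}" for y
  proof -
    have "frac (a + y) = (if frac a + frac y < 1 then frac a + frac y else frac a + frac y - 1)"
      by (rule frac_add)
    moreover have "frac y = y" using that by (simp add: frac_eq)
    ultimately show ?thesis by (auto simp: c_def)
  qed
  have "(\<integral>\<^sup>+y. f (frac (a + y)) \<partial>unif) = (\<integral>\<^sup>+y. f (frac (a + y)) * indicator {0..<1} y \<partial>lborel)"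
    unfolding unif_def by (subst nn_integral_restrict_space) auto
  \<comment> \<open>Points \<open>y < 1 - c\<close> move without wrapping onto
    \<open>{c..<1}\<close>; the others wrap around onto \<open>{0..<c}\<close>. The factor 1 is
    written out to match the affine substitution rule.\<close>
  also have "\<dots> = (\<integral>\<^sup>+y. g (c + 1 * y) * indicator {c..<1} (c + 1 * y) + g (c - 1 + 1 * y) * indicator {0..<c} (c - 1 + 1 * y) \<partial>lborel)"
    using c by (intro nn_integral_cong) (auto simp: indicator_def g_def shift)
  also have "\<dots> = (\<integral>\<^sup>+y. g (c + 1 * y) * indicator {c..<1} (c + 1 * y) \<partial>lborel) + (\<integral>\<^sup>+y. g (c - 1 + 1 * y) * indicator {0..<c} (c - 1 + 1 * y) \<partial>lborel)"
    by (rule nn_integral_add) measurable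
  also have "\<dots> = (\<integral>\<^sup>+y. g y * indicator {c..<1} y \<partial>lborel) + (\<integral>\<^sup>+y. g y * indicator {0..<c} y \<partial>lborel)"
    using nn_integral_real_affine[of "\<lambda>y. g y * indicator {c..<1} y" 1 c]
      nn_integral_real_affine[of "\<lambda>y. g y * indicator {0..<c} y" 1 "c - 1"] by simp
  also have "\<dots> = (\<integral>\<^sup>+y. g y * indicator {c..<1} y + g y * indicator {0..<c} y \<partial>lborel)"
    by (rule nn_integral_add[symmetric]) measurable
  also have "\<dots> = (\<integral>\<^sup>+y. f y * indicator {0..<1} y \<partial>lborel)"
    using c by (intro nn_integral_cong) (auto simp: indicator_def g_def)
  also have "\<dots> = (\<integral>\<^sup>+y. f y \<partial>unif)"
    unfolding unif_def by (subst nn_integral_restrict_space) auto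
  finally show ?thesis .
qed

definition unif_prod :: "nat \<Rightarrow> (nat \<Rightarrow> real) measure" where
  "unif_prod n = Pi\<^sub>M {..<n} (\<lambda>_. unif)"

lemma measurable_coordinate_unif_prod:
  "i < n \<Longrightarrow> (\<lambda>v. v i) \<in> measurable (unif_prod n) unif"
  unfolding unif_prod_def by (rule measurable_component_singleton) simp

lemma measurable_coordinate_unif_prod_borel:
  "i < n \<Longrightarrow> (\<lambda>v. v i) \<in> borel_measurable (unif_prod n)"
  by (rule measurable_compose[OF measurable_coordinate_unif_prod]) (auto intro: measurable_unif_borel)

text \<open>The map from \<open>U\<close> to \<open>V\<close> in the overview;
  \<open>restrict\<close> keeps the result in the product space.\<close>

definition frac_sums :: "nat \<Rightarrow> (nat \<Rightarrow> real) \<Rightarrow> nat \<Rightarrow> real" where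
  "frac_sums n x = (\<lambda>i\<in>{..<n}. frac (\<Sum>j<Suc i. x j))"

lemma frac_sums_measurable: "frac_sums n \<in> measurable (unif_prod n) (unif_prod n)"
proof -
  have "(\<lambda>x. \<lambda>i\<in>{..<n}. frac (\<Sum>j<Suc i. x j)) \<in> measurable (unif_prod n) (Pi\<^sub>M {..<n} (\<lambda>_. unif))"
  proof (rule measurable_restrict, rule measurable_into_unif)
    fix i assume i: "i \<in> {..<n}"
    have "(\<lambda>x. \<Sum>j<Suc i. x j) \<in> borel_measurable (unif_prod n)"
      using i by (intro borel_measurable_sum measurable_coordinate_unif_prod_borel) auto
    moreover have "(frac :: real \<Rightarrow> real) \<in> borel_measurable borel"
      unfolding frac_def[abs_def] by measurable
    ultimately show "(\<lambda>x. frac (\<Sum>j<Suc i. x j)) \<in> borel_measurable (unif_prod n)"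
      by (rule measurable_compose)
  qed (simp add: frac_lt_1)
  then show ?thesis by (simp add: frac_sums_def[abs_def] unif_prod_def)
qed

lemma nn_integral_unif_prod_Suc:
  assumes "f \<in> borel_measurable (unif_prod (Suc n))"
  shows "(\<integral>\<^sup>+x. f x \<partial>unif_prod (Suc n)) = (\<integral>\<^sup>+x. \<integral>\<^sup>+y. f (x(n := y)) \<partial>unif \<partial>unif_prod n)"
  using unif_product.product_nn_integral_insert[of "{..<n}" n f] assms
  by (simp add: unif_prod_def lessThan_Suc)

text \<open>Induction by Fubini. For fixed earlier coordinates the last one is only rotated, by
  their sum, and rotation preserves the inner integral. The remaining integrand depends on the
  earlier coordinates through \<open>frac_sums n\<close>, so the induction hypothesis applies to the
  inner integral as a function of them.\<close>

lemma nn_integral_frac_sums: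
  assumes "f \<in> borel_measurable (unif_prod n)"
  shows "(\<integral>\<^sup>+x. f (frac_sums n x) \<partial>unif_prod n) = (\<integral>\<^sup>+x. f x \<partial>unif_prod n)"
  using assms
proof (induction n arbitrary: f)
  case 0
  have "frac_sums 0 x = x" if "x \<in> space (unif_prod 0)" for x
    using that by (auto simp: frac_sums_def unif_prod_def space_PiM)
  then show ?case by (intro nn_integral_cong) auto
next
  case (Suc n)
  note f = Suc.prems
  have upd: "(\<lambda>(x, y). x(n := y)) \<in> measurable (unif_prod n \<Otimes>\<^sub>M unif) (unif_prod (Suc n))"
    unfolding unif_prod_def lessThan_Suc by (rule measurable_add_dim)
  have sec: "(\<lambda>y. f (x(n := y))) \<in> borel_measurable unif" if "x \<in> space (unif_prod n)" for x
    using measurable_compose[OF measurable_Pair1'[OF that, of unif] measurable_compose[OF upd f]] by (simp add: fun_upd_def)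
  have inner: "(\<lambda>x. \<integral>\<^sup>+y. f (x(n := y)) \<partial>unif) \<in> borel_measurable (unif_prod n)"
    using measurable_compose[OF upd f]
    by (intro unif.borel_measurable_nn_integral) (simp add: case_prod_beta' fun_upd_def)
  have fs: "frac_sums (Suc n) (x(n := y)) = (frac_sums n x)(n := frac ((\<Sum>j<n. x j) + y))" for x y
  proof
    fix i
    show "frac_sums (Suc n) (x(n := y)) i = ((frac_sums n x)(n := frac ((\<Sum>j<n. x j) + y))) i"
    proof (cases "i < n")
      case True
      then have "(\<Sum>j<Suc i. (x(n := y)) j) = (\<Sum>j<Suc i. x j)"
        by (intro sum.cong) auto
      with True show ?thesis by (simp add: frac_sums_def)
    next
      case False
      have "(\<Sum>j<n. (x(n := y)) j) = (\<Sum>j<n. x j)"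
        by (intro sum.cong) auto
      with False show ?thesis by (auto simp: frac_sums_def)
    qed
  qed
  have "(\<integral>\<^sup>+x. f (frac_sums (Suc n) x) \<partial>unif_prod (Suc n))
      = (\<integral>\<^sup>+x. \<integral>\<^sup>+y. f ((frac_sums n x)(n := frac ((\<Sum>j<n. x j) + y))) \<partial>unif \<partial>unif_prod n)"
    by (subst nn_integral_unif_prod_Suc[OF measurable_compose[OF frac_sums_measurable f]]) (simp add: fs)
  also have "\<dots> = (\<integral>\<^sup>+x. \<integral>\<^sup>+y. f ((frac_sums n x)(n := y)) \<partial>unif \<partial>unif_prod n)"
    by (intro nn_integral_cong nn_integral_unif_frac_shift sec measurable_space[OF frac_sums_measurable])
  also have "\<dots> = (\<integral>\<^sup>+x. \<integral>\<^sup>+y. f (x(n := y)) \<partial>unif \<partial>unif_prod n)"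
    by (rule Suc.IH[OF inner])
  also have "\<dots> = (\<integral>\<^sup>+x. f x \<partial>unif_prod (Suc n))"
    by (rule nn_integral_unif_prod_Suc[OF f, symmetric])
  finally show ?case .
qed

lemma distr_frac_sums: "distr (unif_prod n) (unif_prod n) (frac_sums n) = unif_prod n"
proof (rule measure_eqI)
  fix A assume "A \<in> sets (distr (unif_prod n) (unif_prod n) (frac_sums n))"
  then have A: "A \<in> sets (unif_prod n)" by simp
  have "emeasure (distr (unif_prod n) (unif_prod n) (frac_sums n)) A
      = (\<integral>\<^sup>+x. indicator A x \<partial>distr (unif_prod n) (unif_prod n) (frac_sums n))"
    using A by simp
  also have "\<dots> = (\<integral>\<^sup>+x. indicator A (frac_sums n x) \<partial>unif_prod n)"
    using A by (intro nn_integral_distr frac_sums_measurable) auto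
  also have "\<dots> = emeasure (unif_prod n) A"
    using A by (subst nn_integral_frac_sums) auto
  finally show "emeasure (distr (unif_prod n) (unif_prod n) (frac_sums n)) A = emeasure (unif_prod n) A" .
qed simp

text \<open>With every coordinate but \<open>j\<close> fixed, a tie confines coordinate
  \<open>j\<close> to a single point.\<close>

lemma AE_unif_prod_coordinates_distinct:
  assumes "i < n" "j < n" "i \<noteq> j"
  shows "AE v in unif_prod n. v i \<noteq> v j"
proof -
  let ?D = "{v \<in> space (unif_prod n). v i = v j}"
  let ?I = "{..<n} - {j}"
  have D: "?D \<in> sets (unif_prod n)"
    using assms by (intro borel_measurable_eq measurable_coordinate_unif_prod_borel)
  have ins: "insert j ?I = {..<n}" using assms by auto
  have "emeasure (unif_prod n) ?D = (\<integral>\<^sup>+v. indicator ?D v \<partial>Pi\<^sub>M (insert j ?I) (\<lambda>_. unif))"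
    using D unfolding ins by (simp add: unif_prod_def)
  also have "\<dots> = (\<integral>\<^sup>+x. \<integral>\<^sup>+y. indicator ?D (x(j := y)) \<partial>unif \<partial>Pi\<^sub>M ?I (\<lambda>_. unif))"
    using D by (intro unif_product.product_nn_integral_insert) (auto simp only: ins unif_prod_def[symmetric] intro!: borel_measurable_indicator)
  also have "\<dots> = (\<integral>\<^sup>+x. 0 \<partial>Pi\<^sub>M ?I (\<lambda>_. unif))"
  proof (intro nn_integral_cong)
    fix x
    have "(\<integral>\<^sup>+y. indicator ?D (x(j := y)) \<partial>unif) \<le> (\<integral>\<^sup>+y. indicator {x i} y * indicator {0..<1} y \<partial>lborel)"
      unfolding unif_def using assms(3)
      by (subst nn_integral_restrict_space) (auto simp: indicator_def intro!: nn_integral_mono)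
    also have "\<dots> \<le> (\<integral>\<^sup>+y. indicator {x i} y \<partial>lborel)"
      by (intro nn_integral_mono) (auto simp: indicator_def)
    also have "\<dots> = 0" by simp
    finally show "(\<integral>\<^sup>+y. indicator ?D (x(j := y)) \<partial>unif) = 0" by simp
  qed
  finally have "emeasure (unif_prod n) ?D = 0" by simp
  with D show ?thesis by (intro AE_I[of _ _ ?D]) auto
qed

section \<open>Relative order of the coordinates and uniform permutations\<close>

text \<open>Coordinates are indexed from 0, permutations act on \<open>{1..n}\<close>.\<close>

definition order_cell :: "nat \<Rightarrow> (nat \<Rightarrow> nat) \<Rightarrow> (nat \<Rightarrow> real) set" where
  "order_cell n \<sigma> = {v \<in> space (unif_prod n). \<forall>i\<in>{..<n}. \<forall>j\<in>{..<n}. v i < v j \<longleftrightarrow> \<sigma> (Suc i) < \<sigma> (Suc j)}"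

lemma order_cell_sets: "order_cell n \<sigma> \<in> sets (unif_prod n)"
proof -
  have "{v \<in> space (unif_prod n). v i < v j \<longleftrightarrow> \<sigma> (Suc i) < \<sigma> (Suc j)} \<in> sets (unif_prod n)"
    if "i \<in> {..<n}" "j \<in> {..<n}" for i j
  proof -
    have lt: "{v \<in> space (unif_prod n). v i < v j} \<in> sets (unif_prod n)"
      using that by (intro borel_measurable_less measurable_coordinate_unif_prod_borel) auto
    then show ?thesis
      using sets.sets_Collect_neg[OF lt] by (cases "\<sigma> (Suc i) < \<sigma> (Suc j)") auto
  qed
  then show ?thesis
    unfolding order_cell_def by (intro sets.sets_Collect_finite_All) auto
qed

text \<open>The copy of \<open>\<sigma>\<close> on zero-based indices, used to permute
  coordinates.\<close>

lemma permutes_Suc_image: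
  assumes "\<sigma> permutes {1..n}"
  shows "bij_betw (\<lambda>i. \<sigma> (Suc i) - 1) {..<n} {..<n}"
proof -
  have "bij_betw Suc {..<n} {1..n}"
    by (rule bij_betw_byWitness[where f' = "\<lambda>i. i - 1"]) auto
  moreover have "bij_betw \<sigma> {1..n} {1..n}" using assms by (rule permutes_imp_bij)
  moreover have "bij_betw (\<lambda>i. i - 1) {1..n} {..<n}"
    by (rule bij_betw_byWitness[where f' = Suc]) auto
  ultimately show ?thesis
    using bij_betw_trans[OF bij_betw_trans, of Suc "{..<n}" "{1..n}" \<sigma> "{1..n}" "\<lambda>i. i - 1" "{..<n}"]
    by (simp add: comp_def)
qed

text \<open>Permuting the coordinates by the zero-based copy of \<open>\<sigma>\<close> preserves
  the product measure, and the preimage of the cell of \<open>\<sigma>\<close> under this map is the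
  cell of \<open>id\<close>.\<close>

lemma measure_order_cell_eq:
  assumes \<sigma>: "\<sigma> permutes {1..n}"
  shows "measure (unif_prod n) (order_cell n \<sigma>) = measure (unif_prod n) (order_cell n id)"
proof -
  let ?\<tau> = "\<lambda>i. \<sigma> (Suc i) - 1"
  let ?T = "\<lambda>v. \<lambda>i\<in>{..<n}. v (?\<tau> i)"
  have bij: "bij_betw ?\<tau> {..<n} {..<n}" by (rule permutes_Suc_image[OF \<sigma>])
  have pos: "\<sigma> (Suc i) \<ge> 1" if "i < n" for i
    using permutes_in_image[OF \<sigma>, of "Suc i"] that by auto
  have \<tau>: "?\<tau> i < n" if "i < n" for i using bij that by (auto dest: bij_betwE)
  have distr: "distr (unif_prod n) (unif_prod n) ?T = unif_prod n"
    unfolding unif_prod_def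
    by (rule distr_PiM_reindex) (use bij in \<open>auto simp: bij_betw_def prob_space_unif\<close>)
  have T: "?T \<in> measurable (unif_prod n) (unif_prod n)"
    by (subst (2) unif_prod_def) (intro measurable_restrict measurable_coordinate_unif_prod \<tau>, simp)
  have "?T -` order_cell n \<sigma> \<inter> space (unif_prod n) = order_cell n id"
  proof (intro equalityI subsetI)
    fix v assume "v \<in> ?T -` order_cell n \<sigma> \<inter> space (unif_prod n)"
    then have v: "v \<in> space (unif_prod n)"
      and ord: "\<And>i j. i < n \<Longrightarrow> j < n \<Longrightarrow> v (?\<tau> i) < v (?\<tau> j) \<longleftrightarrow> \<sigma> (Suc i) < \<sigma> (Suc j)"
      by (auto simp: order_cell_def)
    have "v a < v b \<longleftrightarrow> a < b" if "a < n" "b < n" for a b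
    proof -
      have "a \<in> ?\<tau> ` {..<n}" "b \<in> ?\<tau> ` {..<n}"
        unfolding bij_betw_imp_surj_on[OF bij] using that by auto
      then obtain i j where "i < n" "j < n" "a = ?\<tau> i" "b = ?\<tau> j" by blast
      then show ?thesis using ord[of i j] pos[of i] pos[of j] by auto
    qed
    with v show "v \<in> order_cell n id" by (auto simp: order_cell_def)
  next
    fix v assume v: "v \<in> order_cell n id"
    then have "?T v \<in> space (unif_prod n)" using measurable_space[OF T] by (auto simp: order_cell_def)
    moreover have "v (?\<tau> i) < v (?\<tau> j) \<longleftrightarrow> \<sigma> (Suc i) < \<sigma> (Suc j)" if "i < n" "j < n" for i j
      using v \<tau>[OF that(1)] \<tau>[OF that(2)] pos[OF that(1)] pos[OF that(2)] by (auto simp: order_cell_def)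
    ultimately show "v \<in> ?T -` order_cell n \<sigma> \<inter> space (unif_prod n)"
      using v by (auto simp: order_cell_def)
  qed
  then show ?thesis
    using measure_distr[OF T order_cell_sets, of \<sigma>] unfolding distr by (simp only:)
qed

text \<open>The positions with coordinate smaller than \<open>v i\<close> are mapped bijectively
  onto the values below \<open>\<sigma> (Suc i)\<close>. Hence \<open>v\<close> determines
  \<open>\<sigma>\<close>, which makes the cells disjoint.\<close>

lemma order_cell_rank:
  assumes \<sigma>: "\<sigma> permutes {1..n}" and v: "v \<in> order_cell n \<sigma>" and i: "i < n"
  shows "\<sigma> (Suc i) = Suc (card {j. j < n \<and> v j < v i})"
proof -
  have bij: "bij_betw (\<lambda>i. \<sigma> (Suc i) - 1) {..<n} {..<n}" by (rule permutes_Suc_image[OF \<sigma>])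
  have in_range: "\<sigma> (Suc j) \<in> {1..n}" if "j < n" for j
    using permutes_in_image[OF \<sigma>, of "Suc j"] that by auto
  have "(\<lambda>i. \<sigma> (Suc i) - 1) ` {j. j < n \<and> v j < v i} = {..<\<sigma> (Suc i) - 1}"
  proof (intro equalityI subsetI)
    fix k assume "k \<in> (\<lambda>i. \<sigma> (Suc i) - 1) ` {j. j < n \<and> v j < v i}"
    then obtain j where "j < n" "v j < v i" "k = \<sigma> (Suc j) - 1" by auto
    then show "k \<in> {..<\<sigma> (Suc i) - 1}"
      using v i in_range[of j] by (auto simp: order_cell_def)
  next
    fix k assume k: "k \<in> {..<\<sigma> (Suc i) - 1}"
    then have "k < n" using in_range[OF i] by auto
    then obtain j where j: "j < n" "k = \<sigma> (Suc j) - 1"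
      using bij unfolding bij_betw_def by (metis (no_types, lifting) imageE lessThan_iff)
    then have "\<sigma> (Suc j) < \<sigma> (Suc i)" using k in_range[of j] by auto
    then have "v j < v i" using v i j by (auto simp: order_cell_def)
    with j show "k \<in> (\<lambda>i. \<sigma> (Suc i) - 1) ` {j. j < n \<and> v j < v i}" by auto
  qed
  moreover have "inj_on (\<lambda>i. \<sigma> (Suc i) - 1) {j. j < n \<and> v j < v i}"
    using bij by (auto simp: bij_betw_def intro: inj_on_subset)
  ultimately have "card {j. j < n \<and> v j < v i} = \<sigma> (Suc i) - 1"
    using card_image by fastforce
  then show ?thesis using in_range[OF i] by auto
qed

lemma order_cell_unique:
  assumes "\<sigma> permutes {1..n}" "\<rho> permutes {1..n}" "v \<in> order_cell n \<sigma>" "v \<in> order_cell n \<rho>"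
  shows "\<sigma> = \<rho>"
proof
  fix a
  show "\<sigma> a = \<rho> a"
  proof (cases "a \<in> {1..n}")
    case True
    then obtain i where "a = Suc i" "i < n" by (cases a) auto
    then show ?thesis
      using order_cell_rank[OF assms(1,3), of i] order_cell_rank[OF assms(2,4), of i] by simp
  next
    case False
    then show ?thesis
      using permutes_not_in[OF assms(1) False] permutes_not_in[OF assms(2) False] by simp
  qed
qed

text \<open>For distinct coordinates the ranks form a permutation; outside \<open>{1..n}\<close> it
  is continued by the identity, as \<open>permutes\<close> demands.\<close>

lemma order_cell_exists:
  assumes v: "v \<in> space (unif_prod n)" and inj: "inj_on v {..<n}"
  shows "\<exists>\<sigma>. \<sigma> permutes {1..n} \<and> v \<in> order_cell n \<sigma>"
proof -
  define r where "r i = card {j. j < n \<and> v j < v i}" for i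
  define \<sigma> where "\<sigma> a = (if a \<in> {1..n} then Suc (r (a - 1)) else a)" for a
  have r_mono: "r i < r j" if "i < n" "j < n" "v i < v j" for i j
    unfolding r_def using that by (intro psubset_card_mono) auto
  have r_iff: "r i < r j \<longleftrightarrow> v i < v j" if "i < n" "j < n" for i j
    using r_mono[of i j] r_mono[of j i] that inj_onD[OF inj, of i j] by (cases "v i" "v j" rule: linorder_cases) auto
  have r_less: "r i < n" if "i < n" for i
  proof -
    have "r i < card {..<n}" unfolding r_def using that by (intro psubset_card_mono) auto
    then show ?thesis by simp
  qed
  have "\<sigma> permutes {1..n}"
  proof (rule bij_imp_permutes)
    have "inj_on \<sigma> {1..n}"
    proof (rule inj_onI)
      fix a b assume ab: "a \<in> {1..n}" "b \<in> {1..n}" "\<sigma> a = \<sigma> b"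
      then have "r (a - 1) = r (b - 1)" by (simp add: \<sigma>_def)
      then have "v (a - 1) = v (b - 1)"
        using r_iff[of "a - 1" "b - 1"] r_iff[of "b - 1" "a - 1"] ab by force
      then have "a - 1 = b - 1" using ab by (intro inj_onD[OF inj]) auto
      then show "a = b" using ab by auto
    qed
    moreover have "\<sigma> ` {1..n} \<subseteq> {1..n}"
    proof (rule image_subsetI)
      fix a assume a: "a \<in> {1..n}"
      then have "r (a - 1) < n" by (intro r_less) auto
      with a show "\<sigma> a \<in> {1..n}" by (auto simp: \<sigma>_def)
    qed
    ultimately show "bij_betw \<sigma> {1..n} {1..n}"
      by (simp add: bij_betw_def endo_inj_surj)
  qed (auto simp: \<sigma>_def)
  moreover have "v \<in> order_cell n \<sigma>"
    using v r_iff by (auto simp: order_cell_def \<sigma>_def)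
  ultimately show ?thesis by blast
qed

text \<open>The descent pattern is constant on each cell, and the cells are equally likely and cover
  almost everything. The first \<open>n\<close> comparisons involve \<open>n + 1\<close>
  coordinates, hence \<open>Suc n\<close>.\<close>

lemma expectation_permutation_eq_unif_prod:
  fixes h :: "(nat \<Rightarrow> real) \<Rightarrow> real"
  assumes h: "\<And>x y. (\<And>i. i < n \<Longrightarrow> x i = y i) \<Longrightarrow> h x = h y"
    and meas: "(\<lambda>v. h (\<lambda>i. if v (Suc i) < v i then - 1 else 1)) \<in> borel_measurable (unif_prod (Suc n))"
  shows "measure_pmf.expectation (pmf_of_set {\<sigma>. \<sigma> permutes {1..n+1}}) (\<lambda>\<sigma>. h (\<lambda>i. step \<sigma> (Suc i)))
    = (\<integral>v. h (\<lambda>i. if v (Suc i) < v i then - 1 else 1) \<partial>unif_prod (Suc n))"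
proof -
  let ?P = "{\<sigma>. \<sigma> permutes {1..Suc n}}" and ?Q = "unif_prod (Suc n)"
  interpret Q: prob_space ?Q unfolding unif_prod_def by (rule prob_space_PiM) (rule prob_space_unif)
  have fin: "finite ?P" by (rule finite_permutations) simp
  have ne: "?P \<noteq> {}" using permutes_id by blast
  have disj: "disjoint_family_on (order_cell (Suc n)) ?P"
    using order_cell_unique by (auto simp: disjoint_family_on_def)
  have pattern: "h (\<lambda>i. if v (Suc i) < v i then - 1 else 1) = h (\<lambda>i. step \<sigma> (Suc i))"
    if "v \<in> order_cell (Suc n) \<sigma>" for v \<sigma>
    using that by (intro h) (auto simp: order_cell_def step_def is_descent_def)
  have "AE v in ?Q. \<forall>i\<in>{..<Suc n}. \<forall>j\<in>{..<Suc n}. i \<noteq> j \<longrightarrow> v i \<noteq> v j"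
    by (intro AE_finite_allI) (auto intro: AE_unif_prod_coordinates_distinct)
  then have cover: "AE v in ?Q. \<exists>\<sigma>\<in>?P. v \<in> order_cell (Suc n) \<sigma>"
  proof (rule AE_mp, intro AE_I2 impI)
    fix v assume "v \<in> space ?Q" "\<forall>i\<in>{..<Suc n}. \<forall>j\<in>{..<Suc n}. i \<noteq> j \<longrightarrow> v i \<noteq> v j"
    then show "\<exists>\<sigma>\<in>?P. v \<in> order_cell (Suc n) \<sigma>"
      using order_cell_exists[of v "Suc n"] by (auto simp: inj_on_def)
  qed
  define p where "p = measure ?Q (order_cell (Suc n) id)"
  have p: "measure ?Q (order_cell (Suc n) \<sigma>) = p" if "\<sigma> \<in> ?P" for \<sigma>
    using that unfolding p_def by (intro measure_order_cell_eq) simp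
  \<comment> \<open>The common measure \<open>p\<close> of the cells comes from counting:
    \<open>card ?P\<close> disjoint cells of equal measure have total measure 1.\<close>
  have "1 = measure ?Q (\<Union>\<sigma>\<in>?P. order_cell (Suc n) \<sigma>)"
    using cover fin by (intro Q.prob_eq_1[THEN iffD2, symmetric]) (auto intro!: order_cell_sets)
  also have "\<dots> = (\<Sum>\<sigma>\<in>?P. measure ?Q (order_cell (Suc n) \<sigma>))"
    using fin disj by (intro Q.finite_measure_finite_Union) (auto intro: order_cell_sets)
  also have "\<dots> = real (card ?P) * p" using p by simp
  finally have p_eq: "p = 1 / real (card ?P)"
    by (metis nonzero_eq_divide_eq mult.commute mult_zero_left zero_neq_one)
  have "(\<integral>v. h (\<lambda>i. if v (Suc i) < v i then - 1 else 1) \<partial>?Q)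
      = (\<integral>v. (\<Sum>\<sigma>\<in>?P. indicator (order_cell (Suc n) \<sigma>) v * h (\<lambda>i. step \<sigma> (Suc i))) \<partial>?Q)"
  proof (rule integral_cong_AE)
    have eq: "h (\<lambda>i. if v (Suc i) < v i then - 1 else 1)
        = (\<Sum>\<sigma>\<in>?P. indicator (order_cell (Suc n) \<sigma>) v * h (\<lambda>i. step \<sigma> (Suc i)))"
      if "\<sigma> \<in> ?P" "v \<in> order_cell (Suc n) \<sigma>" for v \<sigma>
    proof -
      have "(\<Sum>\<rho>\<in>?P. indicator (order_cell (Suc n) \<rho>) v * h (\<lambda>i. step \<rho> (Suc i)))
          = (\<Sum>\<rho>\<in>?P. if \<rho> = \<sigma> then h (\<lambda>i. step \<sigma> (Suc i)) else 0)"
        using that order_cell_unique[of \<sigma> "Suc n"] by (intro sum.cong) (auto simp: indicator_def)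
      also have "\<dots> = h (\<lambda>i. step \<sigma> (Suc i))" using that fin by simp
      finally show ?thesis using pattern[OF that(2)] by simp
    qed
    then show "AE v in ?Q. h (\<lambda>i. if v (Suc i) < v i then - 1 else 1)
        = (\<Sum>\<sigma>\<in>?P. indicator (order_cell (Suc n) \<sigma>) v * h (\<lambda>i. step \<sigma> (Suc i)))"
      using cover by (elim AE_mp, intro AE_I2) blast
    show "(\<lambda>v. \<Sum>\<sigma>\<in>?P. indicator (order_cell (Suc n) \<sigma>) v * h (\<lambda>i. step \<sigma> (Suc i))) \<in> borel_measurable ?Q"
      using order_cell_sets by (intro borel_measurable_sum borel_measurable_times borel_measurable_indicator) auto
  qed (rule meas)
  also have "\<dots> = (\<Sum>\<sigma>\<in>?P. p * h (\<lambda>i. step \<sigma> (Suc i)))"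
    using order_cell_sets p by (subst Bochner_Integration.integral_sum)
      (auto simp: integrable_mult_left Q.emeasure_eq_measure intro!: sum.cong integrable_mult_left integrable_real_indicator)
  also have "\<dots> = measure_pmf.expectation (pmf_of_set ?P) (\<lambda>\<sigma>. h (\<lambda>i. step \<sigma> (Suc i)))"
    using fin ne by (simp add: integral_pmf_of_set p_eq sum_divide_distrib)
  finally show ?thesis by simp
qed

section \<open>Convergence of the descent path\<close>

text \<open>Minus 1 when the integer part of the partial sum jumps by 1, and plus 1 when it stays.
  In this form the steps telescope. The shift by \<open>Suc\<close> is due to
  \<open>\<omega> 0\<close>, which supplies the first value to compare with.\<close>

definition floor_step :: "nat \<Rightarrow> (nat \<Rightarrow> real) \<Rightarrow> real" where
  "floor_step i \<omega> = 1 - 2 * (real_of_int \<lfloor>\<Sum>j<Suc (Suc i). \<omega> j\<rfloor> - real_of_int \<lfloor>\<Sum>j<Suc i. \<omega> j\<rfloor>)"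

text \<open>Adding a number of \<open>{0..<1}\<close> either raises the fractional part or leaves it
  unchanged, or wraps past an integer; in the latter case the fractional part strictly
  drops.\<close>

lemma floor_step_eq_descent:
  assumes "\<omega> (Suc i) \<in> {0..<1}"
  shows "floor_step i \<omega> = (if frac (\<Sum>j<Suc (Suc i). \<omega> j) < frac (\<Sum>j<Suc i. \<omega> j) then - 1 else 1)"
proof -
  let ?a = "\<Sum>j<Suc i. \<omega> j" and ?u = "\<omega> (Suc i)"
  have sum: "(\<Sum>j<Suc (Suc i). \<omega> j) = ?a + ?u" by simp
  have u: "0 \<le> ?u" "?u < 1" using assms by auto
  have "\<lfloor>?a + ?u\<rfloor> = \<lfloor>?a\<rfloor> \<or> \<lfloor>?a + ?u\<rfloor> = \<lfloor>?a\<rfloor> + 1" using u by linarith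
  then show ?thesis
    unfolding floor_step_def sum frac_def using u by auto
qed

lemma floor_step_measurable [measurable]: "floor_step i \<in> borel_measurable unif_seq"
proof -
  have "(\<lambda>\<omega>. real_of_int \<lfloor>\<Sum>j<k. \<omega> j\<rfloor>) \<in> borel_measurable unif_seq" for k
  proof -
    have "(\<lambda>\<omega>. \<Sum>j<k. \<omega> j) \<in> borel_measurable unif_seq"
      by (intro borel_measurable_sum measurable_coordinate_unif_seq_borel)
    moreover have "(\<lambda>x::real. real_of_int \<lfloor>x\<rfloor>) \<in> borel_measurable borel" by measurable
    ultimately show ?thesis by (rule measurable_compose)
  qed
  then show ?thesis
    unfolding floor_step_def[abs_def] by (intro borel_measurable_diff borel_measurable_times borel_measurable_const)
qed

lemma expectation_descent_path:
  assumes F: "bounded_continuous_functional_C01 F"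
  shows "measure_pmf.expectation (pmf_of_set {\<sigma>. \<sigma> permutes {1..n+1}})
      (\<lambda>\<sigma>. F (\<lambda>t. f_perm n \<sigma> (real n * t) / sqrt (real n)))
    = unif_seq.expectation (\<lambda>\<omega>. F (poly_path n (\<lambda>i. floor_step i \<omega> / sqrt (real n))))"
proof -
  define h where "h x = F (poly_path n (\<lambda>i. x i / sqrt (real n)))" for x
  define pat where "pat v = (\<lambda>i. if v (Suc i) < v i then - 1 else 1 :: real)" for v :: "nat \<Rightarrow> real"
  have h: "h x = h y" if "\<And>i. i < n \<Longrightarrow> x i = y i" for x y
    unfolding h_def using that by (simp cong: poly_path_cong)
  have f_perm: "(\<lambda>t. f_perm n \<sigma> (real n * t) / sqrt (real n)) = poly_path n (\<lambda>i. step \<sigma> (Suc i) / sqrt (real n))" for \<sigma>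
  proof
    fix t
    have "f_perm n \<sigma> (real n * t) = (\<Sum>i<n. step \<sigma> (Suc i) * max 0 (min 1 (real n * t - real i)))"
      unfolding f_perm_def
      by (rule sum.reindex_bij_witness[where i = Suc and j = "\<lambda>i. i - 1"]) auto
    then show "f_perm n \<sigma> (real n * t) / sqrt (real n) = poly_path n (\<lambda>i. step \<sigma> (Suc i) / sqrt (real n)) t"
      by (simp add: poly_path_def sum_divide_distrib)
  qed
  have meas: "(\<lambda>v. h (pat v)) \<in> borel_measurable (unif_prod (Suc n))"
    unfolding h_def
  proof (rule measurable_bcf_poly_path[OF F])
    fix i assume "i < n"
    then have "{v \<in> space (unif_prod (Suc n)). v (Suc i) < v i} \<in> sets (unif_prod (Suc n))"
      by (intro borel_measurable_less measurable_coordinate_unif_prod_borel) auto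
    then show "(\<lambda>v. pat v i / sqrt (real n)) \<in> borel_measurable (unif_prod (Suc n))"
      unfolding pat_def by (intro borel_measurable_divide measurable_If) auto
  qed
  have restr: "distr unif_seq (unif_prod (Suc n)) (\<lambda>\<omega>. restrict \<omega> {..<Suc n}) = unif_prod (Suc n)"
    unfolding unif_seq_def unif_prod_def by (rule unif_product.distr_PiM_restrict_finite) auto
  have restr_meas: "(\<lambda>\<omega>. restrict \<omega> {..<Suc n}) \<in> measurable unif_seq (unif_prod (Suc n))"
    unfolding unif_prod_def by (intro measurable_restrict measurable_coordinate_unif_seq)
  have "measure_pmf.expectation (pmf_of_set {\<sigma>. \<sigma> permutes {1..n+1}})
      (\<lambda>\<sigma>. F (\<lambda>t. f_perm n \<sigma> (real n * t) / sqrt (real n)))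
    = measure_pmf.expectation (pmf_of_set {\<sigma>. \<sigma> permutes {1..n+1}}) (\<lambda>\<sigma>. h (\<lambda>i. step \<sigma> (Suc i)))"
    by (simp add: f_perm h_def)
  also have "\<dots> = (\<integral>v. h (pat v) \<partial>unif_prod (Suc n))"
    unfolding pat_def by (rule expectation_permutation_eq_unif_prod[OF h meas[unfolded pat_def]])
  \<comment> \<open>The coupling: the coordinates are replaced by the fractional parts of their
    partial sums, which have the same law.\<close>
  also have "\<dots> = (\<integral>v. h (pat v) \<partial>distr (unif_prod (Suc n)) (unif_prod (Suc n)) (frac_sums (Suc n)))"
    by (simp only: distr_frac_sums)
  also have "\<dots> = (\<integral>x. h (pat (frac_sums (Suc n) x)) \<partial>unif_prod (Suc n))"
    by (rule integral_distr[OF frac_sums_measurable meas])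
  \<comment> \<open>Passage from \<open>Suc n\<close> coordinates to the infinite sequence.\<close>
  also have "\<dots> = (\<integral>x. h (pat (frac_sums (Suc n) x)) \<partial>distr unif_seq (unif_prod (Suc n)) (\<lambda>\<omega>. restrict \<omega> {..<Suc n}))"
    by (simp only: restr)
  also have "\<dots> = unif_seq.expectation (\<lambda>\<omega>. h (pat (frac_sums (Suc n) (restrict \<omega> {..<Suc n}))))"
    by (rule integral_distr[OF restr_meas measurable_compose[OF frac_sums_measurable meas]])
  also have "\<dots> = unif_seq.expectation (\<lambda>\<omega>. h (\<lambda>i. floor_step i \<omega>))"
  proof (intro Bochner_Integration.integral_cong refl h)
    fix \<omega> i assume \<omega>: "\<omega> \<in> space unif_seq" and i: "i < n"
    have fs: "frac_sums (Suc n) (restrict \<omega> {..<Suc n}) k = frac (\<Sum>j<Suc k. \<omega> j)" if "k < Suc n" for k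
    proof -
      have "(\<Sum>j<Suc k. restrict \<omega> {..<Suc n} j) = (\<Sum>j<Suc k. \<omega> j)"
        using that by (intro sum.cong) auto
      with that show ?thesis by (simp add: frac_sums_def del: sum.lessThan_Suc)
    qed
    have "\<omega> (Suc i) \<in> {0..<1}" using \<omega> by (simp add: space_unif_seq)
    from floor_step_eq_descent[of \<omega> i, OF this]
    show "pat (frac_sums (Suc n) (restrict \<omega> {..<Suc n})) i = floor_step i \<omega>"
      unfolding pat_def using fs[of i] fs[of "Suc i"] i by (simp del: sum.lessThan_Suc)
  qed
  finally show ?thesis by (simp add: h_def)
qed

lemma sum_floor_step:
  assumes "\<omega> \<in> space unif_seq"
  shows "(\<Sum>i<k. floor_step i \<omega>) = real k - 2 * real_of_int \<lfloor>\<Sum>j<Suc k. \<omega> j\<rfloor>"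
proof (induction k)
  case 0
  have "\<omega> 0 \<in> {0..<1}" using assms by (simp add: space_unif_seq)
  then have "\<lfloor>\<omega> 0\<rfloor> = 0" by (simp add: floor_eq_iff)
  then show ?case by simp
next
  case (Suc k)
  have "(\<Sum>i<Suc k. floor_step i \<omega>) = (\<Sum>i<k. floor_step i \<omega>) + floor_step k \<omega>" by simp
  also have "\<dots> = real (Suc k) - 2 * real_of_int \<lfloor>\<Sum>j<Suc (Suc k). \<omega> j\<rfloor>"
    using Suc.IH by (simp add: floor_step_def[of k] algebra_simps del: sum.lessThan_Suc)
  finally show ?case .
qed

text \<open>The difference is twice the fractional part of the sum up to index \<open>k\<close>,
  minus twice \<open>\<omega> k\<close>, and both of these numbers before doubling lie in
  \<open>{0..<1}\<close>.\<close>

lemma sum_floor_step_approx: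
  assumes "\<omega> \<in> space unif_seq"
  shows "\<bar>(\<Sum>i<k. floor_step i \<omega>) - 2 * cent.S k \<omega>\<bar> \<le> 2"
proof -
  have "\<omega> k \<in> {0..<1}" using assms by (simp add: space_unif_seq)
  then have "0 \<le> \<omega> k" "\<omega> k < 1" by auto
  moreover have "cent.S k \<omega> = real k / 2 - (\<Sum>j<k. \<omega> j)"
    by (simp add: cent.S_def cent_def sum_subtractf)
  moreover have "(\<Sum>j<Suc k. \<omega> j) = (\<Sum>j<k. \<omega> j) + \<omega> k" by simp
  moreover have "real_of_int \<lfloor>\<Sum>j<Suc k. \<omega> j\<rfloor> \<le> (\<Sum>j<Suc k. \<omega> j)"
    "(\<Sum>j<Suc k. \<omega> j) < real_of_int \<lfloor>\<Sum>j<Suc k. \<omega> j\<rfloor> + 1"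
    by (auto simp del: sum.lessThan_Suc)
  ultimately show ?thesis unfolding sum_floor_step[OF assms] by linarith
qed

section \<open>Comparison of the descent path with its block interpolation\<close>

lemma cent_S_add: "cent.S (a + k) \<omega> = cent.S a \<omega> + (\<Sum>i<k. cent (a + i) \<omega>)"
  by (induction k) (auto simp: cent.S_def)

lemma abs_cent_S_diff_le:
  assumes "\<omega> \<in> space unif_seq"
  shows "\<bar>cent.S (a + k) \<omega> - cent.S a \<omega>\<bar> \<le> real k"
  unfolding cent_S_add using cent.bounded[OF assms]
  by (simp, intro order_trans[OF sum_abs] order_trans[OF sum_bounded_above[where K = 1]]) auto

lemma sum_block: "(\<Sum>j<b. block L j \<omega>) = cent.S (b * L) \<omega>"
proof (induction b)
  case (Suc b)
  then show ?case using cent_S_add[of "b * L" L \<omega>] by (simp add: block_def add.commute)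
qed (simp add: cent.S_def)

text \<open>Balls are convex, once in each argument. Two polygons with different meshes can thus be
  compared at the end points of the two cells that contain \<open>t\<close>.\<close>

lemma convex_combinations_close:
  fixes a b :: real
  assumes "0 \<le> \<theta>" "\<theta> \<le> 1" "0 \<le> \<tau>" "\<tau> \<le> 1"
    and "\<bar>a - b\<bar> \<le> D" "\<bar>a' - b\<bar> \<le> D" "\<bar>a - b'\<bar> \<le> D" "\<bar>a' - b'\<bar> \<le> D"
  shows "\<bar>((1 - \<theta>) * a + \<theta> * a') - ((1 - \<tau>) * b + \<tau> * b')\<bar> \<le> D"
proof -
  have "\<bar>((1 - \<theta>) * a + \<theta> * a') - c\<bar> \<le> D" if "\<bar>a - c\<bar> \<le> D" "\<bar>a' - c\<bar> \<le> D" for c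
  proof -
    have "((1 - \<theta>) * a + \<theta> * a') - c = (1 - \<theta>) * (a - c) + \<theta> * (a' - c)" by (simp add: algebra_simps)
    also have "\<bar>\<dots>\<bar> \<le> (1 - \<theta>) * D + \<theta> * D"
      using assms that by (intro order_trans[OF abs_triangle_ineq] add_mono) (auto simp: abs_mult intro!: mult_left_mono)
    finally show ?thesis by (simp add: algebra_simps)
  qed
  then have bd: "\<bar>((1 - \<theta>) * a + \<theta> * a') - b\<bar> \<le> D" "\<bar>((1 - \<theta>) * a + \<theta> * a') - b'\<bar> \<le> D"
    using assms by auto
  define p where "p = (1 - \<theta>) * a + \<theta> * a'"
  have "p - ((1 - \<tau>) * b + \<tau> * b') = (1 - \<tau>) * (p - b) + \<tau> * (p - b')" by (simp add: algebra_simps)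
  also have "\<bar>\<dots>\<bar> \<le> (1 - \<tau>) * D + \<tau> * D"
    using assms bd unfolding p_def[symmetric]
    by (intro order_trans[OF abs_triangle_ineq] add_mono) (auto simp: abs_mult intro!: mult_left_mono)
  finally show ?thesis by (simp add: algebra_simps p_def)
qed

text \<open>At time \<open>t\<close> the fine path lies between vertices \<open>k\<close> and
  \<open>k + 1\<close>, the coarse one between the ends of block \<open>j\<close>. Up to rounding,
  \<open>k\<close> lies in block \<open>j\<close>, so all four vertices are close to twice
  \<open>S (j * L)\<close>.\<close>

lemma descent_path_block_path_close:
  assumes \<omega>: "\<omega> \<in> space unif_seq" and m: "m > 0" and n: "n > 0" and t: "t \<in> {0..1}"
    and L: "L = n div m"
    and l: "\<And>j k. j < m \<Longrightarrow> k \<le> L \<Longrightarrow> \<bar>\<Sum>i<k. cent (j * L + i) \<omega>\<bar> \<le> l"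
  shows "\<bar>poly_path n (\<lambda>i. floor_step i \<omega> / sqrt (real n)) t - poly_path m (\<lambda>j. 2 * block L j \<omega> / sqrt (real n)) t\<bar>
    \<le> (4 * l + 2 * real m + 4) / sqrt (real n)"
proof -
  obtain k \<theta> where k: "k < n" "0 \<le> \<theta>" "\<theta> \<le> 1" "real n * t = real k + \<theta>"
    and eqk: "\<And>x. poly_path n x t = (1 - \<theta>) * (\<Sum>i<k. x i) + \<theta> * (\<Sum>i<Suc k. x i)"
    by (rule poly_path_convex_combination[OF n t]) blast
  obtain j \<tau> where j: "j < m" "0 \<le> \<tau>" "\<tau> \<le> 1" "real m * t = real j + \<tau>"
    and eqj: "\<And>x. poly_path m x t = (1 - \<tau>) * (\<Sum>i<j. x i) + \<tau> * (\<Sum>i<Suc j. x i)"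
    by (rule poly_path_convex_combination[OF m t]) blast
  have l0: "l \<ge> 0" using l[of 0 0] m by simp
  have cross: "real m * (real k + \<theta>) = real n * (real j + \<tau>)"
    unfolding k(4)[symmetric] j(4)[symmetric] by simp
  \<comment> \<open>Block \<open>j\<close> starts at step \<open>j * L\<close> instead of
    \<open>j * n / m\<close>. These two bounds limit the resulting drift to \<open>m\<close>
    steps.\<close>
  have nL: "m * L \<le> n" "n \<le> m * (L + 1)"
    using m unfolding L by (auto simp: dividend_less_times_div less_imp_le algebra_simps)
  have lower: "j * L \<le> Suc k"
  proof -
    have "real (m * (j * L)) = real (m * L) * real j" by simp
    also have "\<dots> \<le> real n * (real j + \<tau>)" using nL(1) j by (intro mult_mono) (auto simp flip: of_nat_mult)
    also have "\<dots> \<le> real m * real (Suc k)" unfolding cross[symmetric] using k by (intro mult_left_mono) auto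
    finally have "m * (j * L) \<le> m * Suc k" by (simp only: of_nat_mult[symmetric] of_nat_le_iff)
    then show ?thesis using m by (simp only: nat_mult_le_cancel1)
  qed
  have upper: "k \<le> (j + 1) * L + m"
  proof -
    have "real m * real k \<le> real m * (real k + \<theta>)" using k by (intro mult_left_mono) auto
    also have "\<dots> \<le> real n * real (j + 1)" unfolding cross using j by (intro mult_left_mono) auto
    also have "\<dots> \<le> real (m * (L + 1)) * real (j + 1)" using nL(2) by (intro mult_right_mono) (simp_all only: of_nat_le_iff of_nat_0_le_iff)
    finally have "m * k \<le> m * ((L + 1) * (j + 1))" by (simp only: of_nat_mult[symmetric] of_nat_le_iff mult.assoc)
    then have "k \<le> (L + 1) * (j + 1)" using m by (simp only: nat_mult_le_cancel1)
    also have "\<dots> = (j + 1) * L + (j + 1)" by (simp add: algebra_simps)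
    finally show ?thesis using j(1) by simp
  qed
  have in_block: "\<bar>cent.S (j * L + i) \<omega> - cent.S (j * L) \<omega>\<bar> \<le> l" if "i \<le> L" for i
    unfolding cent_S_add using l[OF j(1) that] by simp
  have near: "\<bar>cent.S k' \<omega> - cent.S (j * L) \<omega>\<bar> \<le> l + real m + 1"
    if lo: "j * L \<le> Suc k'" and hi: "k' \<le> (j + 1) * L + m + 1" for k'
  proof -
    \<comment> \<open>The vertex is one step before the block, inside it, or at most
      \<open>m + 1\<close> steps after it. Each step outside the block costs at most 1, as
      \<open>cent\<close> is bounded by 1.\<close>
    consider "j * L = k' + 1" | i where "i \<le> L" "k' = j * L + i" | i where "i \<le> m + 1" "k' = j * L + L + i"
    proof -
      assume A: "j * L = k' + 1 \<Longrightarrow> thesis" "\<And>i. i \<le> L \<Longrightarrow> k' = j * L + i \<Longrightarrow> thesis"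
        "\<And>i. i \<le> m + 1 \<Longrightarrow> k' = j * L + L + i \<Longrightarrow> thesis"
      show thesis
      proof (cases "j * L \<le> k'")
        case False then show thesis using lo by (intro A(1)) simp
      next
        case True
        show thesis
        proof (cases "k' \<le> j * L + L")
          assume "k' \<le> j * L + L" with True show thesis by (intro A(2)[of "k' - j * L"]) auto
        next
          assume "\<not> k' \<le> j * L + L" then show thesis
            using hi by (intro A(3)[of "k' - (j * L + L)"]) (auto simp: algebra_simps)
        qed
      qed
    qed
    then show ?thesis
    proof cases
      case 1
      then show ?thesis using abs_cent_S_diff_le[OF \<omega>, of k' 1] l0 by simp
    next
      case 2
      then show ?thesis using in_block[of i] by simp
    next
      case 3
      have "\<bar>cent.S k' \<omega> - cent.S (j * L + L) \<omega>\<bar> \<le> real (m + 1)"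
        unfolding 3(2) using abs_cent_S_diff_le[OF \<omega>, of "j * L + L" i] 3(1) by simp
      then show ?thesis using in_block[of L] by simp
    qed
  qed
  have blk: "\<bar>cent.S ((j + 1) * L) \<omega> - cent.S (j * L) \<omega>\<bar> \<le> l"
    using in_block[of L] by (simp add: add.commute)
  define y z where "y k = (\<Sum>i<k. floor_step i \<omega>)" and "z b = 2 * cent.S (b * L) \<omega>" for k b
  \<comment> \<open>The constant is made of 2 from the floor approximation,
    \<open>2 * (l + m + 1)\<close> from the fine vertex, and \<open>2 * l\<close> from the end of
    the block.\<close>
  have close: "\<bar>y k' / sqrt (real n) - z j' / sqrt (real n)\<bar> \<le> (4 * l + 2 * real m + 4) / sqrt (real n)"
    if "k' \<in> {k, Suc k}" "j' \<in> {j, Suc j}" for k' j'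
  proof -
    have "\<bar>cent.S k' \<omega> - cent.S (j * L) \<omega>\<bar> \<le> l + real m + 1"
      using that(1) lower upper by (intro near) auto
    moreover have "\<bar>cent.S (j' * L) \<omega> - cent.S (j * L) \<omega>\<bar> \<le> l"
      using that(2) blk l0 by auto
    moreover have "\<bar>y k' - 2 * cent.S k' \<omega>\<bar> \<le> 2"
      unfolding y_def by (rule sum_floor_step_approx[OF \<omega>])
    ultimately have "\<bar>y k' - z j'\<bar> \<le> 4 * l + 2 * real m + 4"
      unfolding z_def by linarith
    then show ?thesis
      by (simp flip: diff_divide_distrib add: divide_right_mono)
  qed
  have sums: "(\<Sum>i<k'. floor_step i \<omega> / sqrt (real n)) = y k' / sqrt (real n)"
    "(\<Sum>i<b. 2 * block L i \<omega> / sqrt (real n)) = z b / sqrt (real n)" for k' b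
    unfolding y_def z_def sum_block[symmetric] by (simp_all add: sum_divide_distrib sum_distrib_left)
  show ?thesis
    unfolding eqk eqj sums by (intro convex_combinations_close k j close) auto
qed

text \<open>A union bound over the blocks; shift invariance carries the maximal inequality for the
  initial block to each of them.\<close>

lemma prob_block_oscillation_le:
  assumes "l > 0"
  shows "unif_seq.prob {\<omega> \<in> space unif_seq. \<exists>j<m. \<exists>k\<le>L. l \<le> \<bar>\<Sum>i<k. cent (j * L + i) \<omega>\<bar>}
    \<le> real m * (3 * real L ^ 2 / l ^ 4)"
proof -
  let ?E = "{\<omega> \<in> space unif_seq. \<exists>k\<le>L. l \<le> \<bar>cent.S k \<omega>\<bar>}"
  let ?A = "\<lambda>j. {\<omega> \<in> space unif_seq. \<exists>k\<le>L. l \<le> \<bar>\<Sum>i<k. cent (j * L + i) \<omega>\<bar>}"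
  have E: "?E \<in> sets unif_seq" by measurable
  have A: "?A j \<in> sets unif_seq" for j by measurable
  have "unif_seq.prob (?A j) \<le> 3 * real L ^ 2 / l ^ 4" for j
  proof -
    let ?T = "\<lambda>\<omega> i. \<omega> (j * L + i) :: real"
    have "unif_seq.prob ?E = measure (distr unif_seq unif_seq ?T) ?E"
      by (simp only: distr_shift_unif_seq)
    also have "\<dots> = unif_seq.prob (?T -` ?E \<inter> space unif_seq)"
      by (rule measure_distr[OF measurable_shift_unif_seq E])
    also have "?T -` ?E \<inter> space unif_seq = ?A j"
      by (auto simp: space_unif_seq cent.S_def cent_def)
    finally show ?thesis using cent.maximal_inequality[OF assms, of L] by simp
  qed
  then have "unif_seq.prob (\<Union>j\<in>{..<m}. ?A j) \<le> (\<Sum>j<m. 3 * real L ^ 2 / l ^ 4)"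
    using A by (intro order_trans[OF unif_seq.finite_measure_subadditive_finite] sum_mono) auto
  moreover have "{\<omega> \<in> space unif_seq. \<exists>j<m. \<exists>k\<le>L. l \<le> \<bar>\<Sum>i<k. cent (j * L + i) \<omega>\<bar>} = (\<Union>j\<in>{..<m}. ?A j)"
    by auto
  ultimately show ?thesis by simp
qed

text \<open>Outside the event \<open>A\<close> of a large oscillation within some block, the paths
  are uniformly close and the Lipschitz bound applies; on \<open>A\<close> the trivial bound
  \<open>2 * C\<close> is used.\<close>

lemma descent_block_expectation_close:
  assumes F: "bounded_lipschitz_functional_C01 C K F" and m: "m > 0" and n: "n > 0" and \<eta>: "\<eta> > 0"
  shows "\<bar>unif_seq.expectation (\<lambda>\<omega>. F (poly_path n (\<lambda>i. floor_step i \<omega> / sqrt (real n))))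
      - unif_seq.expectation (\<lambda>\<omega>. F (poly_path m (\<lambda>j. 2 * block (n div m) j \<omega> / sqrt (real n))))\<bar>
    \<le> K * (4 * \<eta> + (2 * real m + 4) / sqrt (real n)) + 6 * C / (real m * \<eta> ^ 4)"
proof -
  let ?L = "n div m"
  let ?Y = "\<lambda>\<omega>. poly_path n (\<lambda>i. floor_step i \<omega> / sqrt (real n))"
  let ?Z = "\<lambda>\<omega>. poly_path m (\<lambda>j. 2 * block ?L j \<omega> / sqrt (real n))"
  define l where "l = \<eta> * sqrt (real n)"
  define A where "A = {\<omega> \<in> space unif_seq. \<exists>j<m. \<exists>k\<le>?L. l \<le> \<bar>\<Sum>i<k. cent (j * ?L + i) \<omega>\<bar>}"
  define D where "D = 4 * \<eta> + (2 * real m + 4) / sqrt (real n)"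
  have l: "l > 0" using \<eta> n by (simp add: l_def)
  have D_eq: "(4 * l + 2 * real m + 4) / sqrt (real n) = D"
    using n by (simp add: l_def D_def add_divide_distrib)
  have Fc: "bounded_continuous_functional_C01 F" by (rule bounded_lipschitz_imp_continuous[OF F])
  have K: "K \<ge> 0" and bd: "\<And>g. continuous_on {0..1} g \<Longrightarrow> \<bar>F g\<bar> \<le> C"
    using F by (auto simp: bounded_lipschitz_functional_C01_def)
  have C: "C \<ge> 0" using bd[OF continuous_on_const[of _ 0]] by linarith
  have A_sets: "A \<in> sets unif_seq" unfolding A_def by measurable
  have int: "integrable unif_seq (\<lambda>\<omega>. F (?Y \<omega>))" "integrable unif_seq (\<lambda>\<omega>. F (?Z \<omega>))"
    by (rule cent.integrable_bounded[where B = C], rule measurable_bcf_poly_path[OF Fc], measurable,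
        rule bd, rule continuous_on_poly_path)+
  have D0: "D \<ge> 0" using \<eta> by (simp add: D_def)
  have pointwise: "\<bar>F (?Y \<omega>) - F (?Z \<omega>)\<bar> \<le> K * D + 2 * C * indicator A \<omega>" if \<omega>: "\<omega> \<in> space unif_seq" for \<omega>
  proof (cases "\<omega> \<in> A")
    case True
    have "\<bar>F (?Y \<omega>)\<bar> \<le> C" "\<bar>F (?Z \<omega>)\<bar> \<le> C" by (intro bd continuous_on_poly_path)+
    moreover have "0 \<le> K * D" using K D0 by simp
    ultimately show ?thesis using True by simp
  next
    case False
    then have "\<bar>\<Sum>i<k. cent (j * ?L + i) \<omega>\<bar> \<le> l" if "j < m" "k \<le> ?L" for j k
      using \<omega> that unfolding A_def by force
    then have "\<forall>t\<in>{0..1}. \<bar>?Y \<omega> t - ?Z \<omega> t\<bar> \<le> D"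
      using descent_path_block_path_close[OF \<omega> m n _ refl, of _ l] by (simp add: D_eq)
    then have "\<bar>F (?Y \<omega>) - F (?Z \<omega>)\<bar> \<le> K * D"
      using F continuous_on_poly_path unfolding bounded_lipschitz_functional_C01_def by blast
    then show ?thesis using False by simp
  qed
  \<comment> \<open>With \<open>L \<le> n / m\<close> and \<open>l = \<eta> * sqrt n\<close> the
    powers of \<open>n\<close> cancel in \<open>m * 3 * L^2 / l^4\<close>, which leaves a bound
    uniform in \<open>n\<close> that decays in \<open>m\<close>.\<close>
  have prob_bound: "unif_seq.prob A \<le> 3 / (real m * \<eta> ^ 4)"
  proof -
    have "real m * real ?L \<le> real n"
      by (metis of_nat_le_iff of_nat_mult times_div_less_eq_dividend)
    then have "(real m * real ?L) ^ 2 \<le> real n ^ 2" by (intro power_mono) auto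
    moreover have "l ^ 4 = \<eta> ^ 4 * real n ^ 2"
      using n by (simp add: l_def power_mult_distrib power4_eq_xxxx power2_eq_square)
    ultimately have "real m * (3 * real ?L ^ 2 / l ^ 4) \<le> 3 / (real m * \<eta> ^ 4)"
      using m n \<eta> by (simp add: field_simps power2_eq_square)
    with prob_block_oscillation_le[OF l, of m ?L] show ?thesis unfolding A_def by linarith
  qed
  have int_rhs: "integrable unif_seq (\<lambda>\<omega>. K * D + 2 * C * indicator A \<omega>)"
    using A_sets by (intro Bochner_Integration.integrable_add integrable_mult_right integrable_real_indicator)
      (auto simp: unif_seq.emeasure_eq_measure)
  have "\<bar>unif_seq.expectation (\<lambda>\<omega>. F (?Y \<omega>)) - unif_seq.expectation (\<lambda>\<omega>. F (?Z \<omega>))\<bar>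
      = \<bar>unif_seq.expectation (\<lambda>\<omega>. F (?Y \<omega>) - F (?Z \<omega>))\<bar>"
    using int by simp
  also have "\<dots> \<le> unif_seq.expectation (\<lambda>\<omega>. \<bar>F (?Y \<omega>) - F (?Z \<omega>)\<bar>)"
    by (rule integral_abs_bound)
  also have "\<dots> \<le> unif_seq.expectation (\<lambda>\<omega>. K * D + 2 * C * indicator A \<omega>)"
    using int int_rhs pointwise by (intro integral_mono) auto
  also have "\<dots> = K * D + 2 * C * unif_seq.prob A"
    using A_sets by (subst Bochner_Integration.integral_add)
      (auto simp: unif_seq.prob_space unif_seq.emeasure_eq_measure intro!: integrable_mult_right integrable_real_indicator)
  also have "\<dots> \<le> K * D + 2 * C * (3 / (real m * \<eta> ^ 4))"
    using prob_bound C by (intro add_left_mono mult_left_mono) auto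
  finally show ?thesis by (simp add: D_def)
qed

text \<open>Five errors of size \<open>e / 5\<close>: two are controlled by \<open>m\<close>, two by
  \<open>n\<close>, and one by \<open>\<eta>\<close>. They are fixed in the order
  \<open>\<eta>\<close>, \<open>m\<close>, \<open>n\<close>, since the bounds for \<open>m\<close>
  involve \<open>\<eta>\<close> and those for \<open>n\<close> involve \<open>m\<close>.\<close>

lemma descent_path_limit_lipschitz:
  assumes F: "bounded_lipschitz_functional_C01 C K F"
    and block_lim: "\<And>m. m > 0 \<Longrightarrow>
      (\<lambda>n. unif_seq.expectation (\<lambda>\<omega>. F (poly_path m (\<lambda>j. 2 * block (n div m) j \<omega> / sqrt (real n))))) \<longlonglongrightarrow> b m"
    and b_lim: "b \<longlonglongrightarrow> c"
  shows "(\<lambda>n. unif_seq.expectation (\<lambda>\<omega>. F (poly_path n (\<lambda>i. floor_step i \<omega> / sqrt (real n))))) \<longlonglongrightarrow> c"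
    (is "?Y \<longlonglongrightarrow> c")
proof (rule tendstoI)
  fix e :: real assume e: "e > 0"
  let ?Z = "\<lambda>m n. unif_seq.expectation (\<lambda>\<omega>. F (poly_path m (\<lambda>j. 2 * block (n div m) j \<omega> / sqrt (real n))))"
  have K: "K \<ge> 0" using F by (simp add: bounded_lipschitz_functional_C01_def)
  \<comment> \<open>This makes \<open>4 * K * \<eta>\<close> equal to \<open>e / 5\<close> times
    \<open>K / (K + 1)\<close>, also when \<open>K = 0\<close>.\<close>
  define \<eta> where "\<eta> = e / (20 * (K + 1))"
  have \<eta>: "\<eta> > 0" using e K by (simp add: \<eta>_def)
  have K\<eta>: "K * (4 * \<eta>) < e / 5"
    using e K by (simp add: \<eta>_def field_simps)
  have "(\<lambda>m. 6 * C / \<eta> ^ 4 * (1 / real m)) \<longlonglongrightarrow> 6 * C / \<eta> ^ 4 * 0"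
    by (intro tendsto_mult tendsto_const lim_1_over_n)
  then have "eventually (\<lambda>m. 6 * C / \<eta> ^ 4 * (1 / real m) < e / 5) sequentially"
    using e by (intro order_tendstoD) auto
  moreover have "eventually (\<lambda>m. dist (b m) c < e / 5) sequentially"
    using b_lim e by (intro tendstoD) auto
  ultimately have "eventually (\<lambda>m. 6 * C / \<eta> ^ 4 * (1 / real m) < e / 5 \<and> dist (b m) c < e / 5 \<and> m > 0) sequentially"
    using eventually_gt_at_top[of 0] by eventually_elim auto
  then obtain m where m: "6 * C / (real m * \<eta> ^ 4) < e / 5" "dist (b m) c < e / 5" "m > 0"
    by (auto simp: eventually_sequentially mult.commute)
  have "(\<lambda>n. K * ((2 * real m + 4) * (1 / sqrt (real n)))) \<longlonglongrightarrow> K * ((2 * real m + 4) * 0)"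
    by (intro tendsto_mult tendsto_const)
       (rule tendsto_divide_0[OF tendsto_const] filterlim_at_top_imp_at_infinity
          filterlim_compose[OF sqrt_at_top filterlim_real_sequentially])+
  then have "eventually (\<lambda>n. K * ((2 * real m + 4) * (1 / sqrt (real n))) < e / 5) sequentially"
    using e by (intro order_tendstoD) auto
  moreover have "eventually (\<lambda>n. dist (?Z m n) (b m) < e / 5) sequentially"
    using block_lim[OF m(3)] e by (intro tendstoD) auto
  ultimately show "eventually (\<lambda>n. dist (?Y n) c < e) sequentially"
    using eventually_gt_at_top[of 0]
  proof eventually_elim
    case (elim n)
    have "\<bar>?Y n - ?Z m n\<bar> \<le> K * (4 * \<eta> + (2 * real m + 4) / sqrt (real n)) + 6 * C / (real m * \<eta> ^ 4)"
      by (rule descent_block_expectation_close[OF F m(3) elim(3) \<eta>])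
    also have "\<dots> = K * (4 * \<eta>) + K * ((2 * real m + 4) * (1 / sqrt (real n))) + 6 * C / (real m * \<eta> ^ 4)"
      by (simp add: distrib_left)
    finally show ?case
      using elim m(1,2) K\<eta> unfolding dist_real_def by linarith
  qed
qed

theorem theorem33:
  fixes M :: "'a measure" and B :: "'a \<Rightarrow> real \<Rightarrow> real"
  assumes "standard_BM_01 M B"
  shows "\<forall>F. bounded_continuous_functional_C01 F \<longrightarrow>
    (\<lambda>n. measure_pmf.expectation (pmf_of_set {\<sigma>. \<sigma> permutes {1..n+1}})
            (\<lambda>\<sigma>. F (\<lambda>t. f_perm n \<sigma> (real n * t) / sqrt (real n))))
    \<longlonglongrightarrow> prob_space.expectation M (\<lambda>\<omega>. F (\<lambda>t. B \<omega> t / sqrt 3))"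
proof (intro allI impI)
  fix F assume F: "bounded_continuous_functional_C01 F"
  have M: "prob_space M"
    and B0: "\<And>\<omega>. \<omega> \<in> space M \<Longrightarrow> B \<omega> 0 = 0"
    and Bcont: "\<And>\<omega>. \<omega> \<in> space M \<Longrightarrow> continuous_on {0..1} (B \<omega>)"
    and Bdistr: "\<And>s t. 0 \<le> s \<Longrightarrow> s < t \<Longrightarrow> t \<le> 1 \<Longrightarrow>
      distributed M lborel (\<lambda>\<omega>. B \<omega> t - B \<omega> s) (normal_density 0 (sqrt (t - s)))"
    and Bindep: "\<And>(k::nat) (ts::nat \<Rightarrow> real). ts 0 \<ge> 0 \<Longrightarrow> ts k \<le> 1 \<Longrightarrow> \<forall>i<k. ts i < ts (Suc i) \<Longrightarrow>
      prob_space.indep_vars M (\<lambda>_. borel) (\<lambda>i \<omega>. B \<omega> (ts (Suc i)) - B \<omega> (ts i)) {..<k}"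
    using assms unfolding standard_BM_01_def by blast+
  interpret M: prob_space M by (rule M)
  \<comment> \<open>The scaling by \<open>1 / sqrt 3\<close> is put into the increments, so that
    their polygon interpolates the target path itself; the standard deviation is
    \<open>1 / sqrt (3 * m)\<close>, as in \<open>block_path_limit\<close>.\<close>
  define Z where "Z m j \<omega> = B \<omega> (real (Suc j) / real m) / sqrt 3 - B \<omega> (real j / real m) / sqrt 3" for m j \<omega>
  have Z_distr: "distributed M lborel (Z m j) (normal_density 0 (1 / sqrt (3 * real m)))" if "j < m" for m j
  proof -
    have "distributed M lborel (\<lambda>\<omega>. B \<omega> (real (Suc j) / real m) - B \<omega> (real j / real m))
        (normal_density 0 (sqrt (real (Suc j) / real m - real j / real m)))"
      using that by (intro Bdistr) (auto simp: divide_strict_right_mono)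
    moreover have "real (Suc j) / real m - real j / real m = 1 / real m"
      by (simp flip: diff_divide_distrib)
    ultimately have "distributed M lborel (\<lambda>\<omega>. 0 + 1 / sqrt 3 * (B \<omega> (real (Suc j) / real m) - B \<omega> (real j / real m)))
        (normal_density (0 + 1 / sqrt 3 * 0) (\<bar>1 / sqrt 3\<bar> * sqrt (1 / real m)))"
      using that by (intro M.normal_density_affine) auto
    then show ?thesis
      by (simp add: Z_def[abs_def] diff_divide_distrib real_sqrt_divide real_sqrt_mult)
  qed
  have Z_meas: "Z m j \<in> borel_measurable M" if "j < m" for m j
    using distributed_measurable[OF Z_distr[OF that]] by simp
  have Z_indep: "M.indep_vars (\<lambda>_. borel) (Z m) {..<m}" if "m > 0" for m
  proof -
    have "M.indep_vars (\<lambda>_. borel) (\<lambda>i \<omega>. B \<omega> (real (Suc i) / real m) - B \<omega> (real i / real m)) {..<m}"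
      using that by (intro Bindep[of "\<lambda>i. real i / real m" m]) (auto simp: divide_strict_right_mono)
    then have "M.indep_vars (\<lambda>_. borel) (\<lambda>i \<omega>. (B \<omega> (real (Suc i) / real m) - B \<omega> (real i / real m)) / sqrt 3) {..<m}"
      by (rule M.indep_vars_compose2) auto
    then show ?thesis by (simp add: Z_def[abs_def] diff_divide_distrib)
  qed
  have path_cont: "continuous_on {0..1} (\<lambda>t. B \<omega> t / sqrt 3)" if "\<omega> \<in> space M" for \<omega>
    using Bcont[OF that] by (intro continuous_on_divide continuous_on_const) auto
  have path_lim: "(\<lambda>m. G (poly_path m (\<lambda>j. Z m j \<omega>))) \<longlonglongrightarrow> G (\<lambda>t. B \<omega> t / sqrt 3)"
    if "bounded_continuous_functional_C01 G" "\<omega> \<in> space M" for G \<omega>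
    unfolding Z_def using that by (intro bcf_poly_path_increments_tendsto path_cont) (auto simp: B0)
  have Z_path_meas: "(\<lambda>\<omega>. G (poly_path m (\<lambda>j. Z m j \<omega>))) \<in> borel_measurable M"
    if "bounded_continuous_functional_C01 G" for G m
    using that by (intro measurable_bcf_poly_path Z_meas)
  \<comment> \<open>\<open>standard_BM_01\<close> provides measurability of increments only; for
    functionals of the whole path it follows by a pointwise limit of polygons.\<close>
  have path_meas: "(\<lambda>\<omega>. G (\<lambda>t. B \<omega> t / sqrt 3)) \<in> borel_measurable M"
    if "bounded_continuous_functional_C01 G" for G
    by (rule borel_measurable_LIMSEQ_real[OF path_lim[OF that] Z_path_meas[OF that]])
  have fcont: "continuous_on {0..1} (\<lambda>t. f_perm n \<sigma> (real n * t) / sqrt (real n))" for n \<sigma>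
    unfolding f_perm_def divide_inverse
    by (intro continuous_on_mult continuous_on_sum continuous_on_const continuous_on_max continuous_on_min
        continuous_on_diff continuous_on_id)
  show "(\<lambda>n. measure_pmf.expectation (pmf_of_set {\<sigma>. \<sigma> permutes {1..n+1}})
            (\<lambda>\<sigma>. F (\<lambda>t. f_perm n \<sigma> (real n * t) / sqrt (real n))))
    \<longlonglongrightarrow> M.expectation (\<lambda>\<omega>. F (\<lambda>t. B \<omega> t / sqrt 3))"
  proof (rule expectation_tendsto_of_lipschitz[where X = "\<lambda>n \<sigma> t. f_perm n \<sigma> (real n * t) / sqrt (real n)"
        and Y = "\<lambda>\<omega> t. B \<omega> t / sqrt 3", OF _ M fcont path_cont _ path_meas _ F])
    fix C K G assume G: "bounded_lipschitz_functional_C01 C K G"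
    have Gc: "bounded_continuous_functional_C01 G" by (rule bounded_lipschitz_imp_continuous[OF G])
    have GC: "\<bar>G g\<bar> \<le> C" if "continuous_on {0..1} g" for g
      using G that by (simp add: bounded_lipschitz_functional_C01_def)
    \<comment> \<open>The limit in \<open>m\<close>, taken on the Brownian side only; the limit in
      \<open>n\<close> for fixed \<open>m\<close> is \<open>block_path_limit\<close>.\<close>
    have "(\<lambda>m. M.expectation (\<lambda>\<omega>. G (poly_path m (\<lambda>j. Z m j \<omega>)))) \<longlonglongrightarrow> M.expectation (\<lambda>\<omega>. G (\<lambda>t. B \<omega> t / sqrt 3))"
      by (rule integral_dominated_convergence[where w = "\<lambda>_. C"])
         (auto simp: GC continuous_on_poly_path intro!: path_meas Z_path_meas path_lim Gc)
    from descent_path_limit_lipschitz[OF G block_path_limit[OF M _ Z_indep Z_distr Gc] this]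
    show "(\<lambda>n. measure_pmf.expectation (pmf_of_set {\<sigma>. \<sigma> permutes {1..n+1}})
            (\<lambda>\<sigma>. G (\<lambda>t. f_perm n \<sigma> (real n * t) / sqrt (real n))))
      \<longlonglongrightarrow> M.expectation (\<lambda>\<omega>. G (\<lambda>t. B \<omega> t / sqrt 3))"
      unfolding expectation_descent_path[OF Gc] by simp
  qed (auto intro: measure_pmf.prob_space_axioms)
qed

end
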